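(* Let $d\ge 3$ be an integer and fix $u_0$ with $0<u_0\le 1/2$. If $u=u(n)$ is a sequence with $u(n)\to u_0$ as $n\to\infty$, then \[ I_{V,u}(d)\ \ge\ A_d(u_0). \]
   Context: For a graph with vertex set $V$ and $U\subseteq V$, $\partial_V U$ is the set of vertices not in $U$ that are adjacent to some vertex of $U$. $\mathcal G_{n,d}$ is the uniform probability space on simple $d$-regular graphs on $n$ (labelled) vertices ($dn$ even; $n\to\infty$ through such $n$). A property holds a.a.s. if its probability tends to $1$ as $n\to\infty$. For a sequence $u=u(n)$ with $0<u\le 1$ for all $n$ (and $u(n)n$ an integer), the $u$-vertex expansion number is \[ I_{V,u}(d)=\sup\Big\{\ell:\ \min_{U\subset V,\ |U|=un}\frac{|\partial_V U|}{un}\ge \ell\ \text{ a.a.s. in }\mathcal G_{n,d}\Big\}. \] The quantity $A_d(u)$, $0<u\le 1/2$. With the convention $0\log 0=0$, let \[ \begin{aligned} f_{d}(u,s,y,x)=\ & du\log(du)+\tfrac12(d-du-y)\log(d-du-y)+s\log\big((x+1)^{d}-1\big)-y\log x -u\log u\\ &-s\log s -(1-u-s)\log(1-u-s)-\tfrac12(du-y)\log(du-y)-\tfrac12 d\log d . \end{aligned} \] For $0<y<du$ let $\hat x(y)=\sqrt{(du-y)/(d-du-y)}$, $\hat s(y)=\dfrac{y\big((\hat x(y)+1)^{d}-1\big)}{\hat x(y)\,d\,(\hat x(y)+1)^{d-1}}$, and $F_{d,u}(y)=f_d(u,\hat s(y),y,\hat x(y))$ (for those $y$ with $\hat s(y)\le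 1-u$). $F_{d,u}$ has a unique zero $\bar y_{d,u}$ in $(0,du(1-u))$, and $A_d(u)=\hat s(\bar y_{d,u})/u$. *)

theory Defs
  imports "HOL-Library.Ramsey" "HOL-Probability.Probability"
begin

text \<open>A simple graph with vertex set \<open>V\<close> is represented by its edge set \<open>E \<subseteq> [V]\<^bsup>2\<^esup>\<close>,
  where \<open>[V]\<^bsup>2\<^esup>\<close> (written \<^const>\<open>nsets\<close>) is the set of two-element subsets of \<open>V\<close>.\<close>

definition regular_graphs :: "nat \<Rightarrow> nat \<Rightarrow> nat set set set" where
  "regular_graphs n d =
     {E. E \<subseteq> nsets {..<n} 2 \<and> (\<forall>v<n. card {e \<in> E. v \<in> e} = d)}"

definition vertex_boundary :: "'a set set \<Rightarrow> 'a set \<Rightarrow> 'a set" where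
  "vertex_boundary E U = {w. w \<notin> U \<and> (\<exists>v\<in>U. {v, w} \<in> E)}"

text \<open>The distribution below is meaningful only if \<open>regular_graphs n d\<close> is nonempty,
  which holds whenever \<open>d * n\<close> is even and \<open>n > d\<close>.\<close>

definition random_regular_graph :: "nat \<Rightarrow> nat \<Rightarrow> nat set set pmf" where
  "random_regular_graph n d = pmf_of_set (regular_graphs n d)"

definition admissible_orders :: "nat \<Rightarrow> nat filter" where
  "admissible_orders d = inf sequentially (principal {n. even (d * n)})"

definition aas_regular :: "nat \<Rightarrow> (nat \<Rightarrow> nat set set \<Rightarrow> bool) \<Rightarrow> bool" where
  "aas_regular d P \<longleftrightarrow>
     ((\<lambda>n. measure_pmf.prob (random_regular_graph n d) {E. P n E}) \<longlongrightarrow> 1)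
       (admissible_orders d)"

definition min_vertex_expansion :: "real \<Rightarrow> nat \<Rightarrow> nat set set \<Rightarrow> real" where
  "min_vertex_expansion r n E =
     Min ((\<lambda>U. real (card (vertex_boundary E U)) / (r * real n)) `
            {U. U \<subseteq> {..<n} \<and> real (card U) = r * real n})"

definition vertex_expansion_number :: "(nat \<Rightarrow> real) \<Rightarrow> nat \<Rightarrow> real" where
  "vertex_expansion_number u d =
     Sup {l. aas_regular d (\<lambda>n E. min_vertex_expansion (u n) n E \<ge> l)}"

text \<open>The convention \<open>0 log 0 = 0\<close> is automatic, since \<open>ln 0 = 0\<close>.\<close>

definition f_exp :: "nat \<Rightarrow> real \<Rightarrow> real \<Rightarrow> real \<Rightarrow> real \<Rightarrow> real" where
  "f_exp d u s y x =
     real d * u * ln (real d * u)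
     + 1/2 * (real d - real d * u - y) * ln (real d - real d * u - y)
     + s * ln ((x + 1) ^ d - 1) - y * ln x - u * ln u
     - s * ln s - (1 - u - s) * ln (1 - u - s)
     - 1/2 * (real d * u - y) * ln (real d * u - y)
     - 1/2 * real d * ln (real d)"

definition x_hat :: "nat \<Rightarrow> real \<Rightarrow> real \<Rightarrow> real" where
  "x_hat d u y = sqrt ((real d * u - y) / (real d - real d * u - y))"

definition s_hat :: "nat \<Rightarrow> real \<Rightarrow> real \<Rightarrow> real" where
  "s_hat d u y =
     y * ((x_hat d u y + 1) ^ d - 1) / (x_hat d u y * real d * (x_hat d u y + 1) ^ (d - 1))"

definition F_exp :: "nat \<Rightarrow> real \<Rightarrow> real \<Rightarrow> real" where
  "F_exp d u y = f_exp d u (s_hat d u y) y (x_hat d u y)"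

text \<open>\<open>F_exp d u\<close> is to be considered only at those \<open>y\<close> with \<open>s_hat d u y \<le> 1 - u\<close>;
  elsewhere \<^const>\<open>f_exp\<close> involves the logarithm of a negative number.\<close>

definition y_bar :: "nat \<Rightarrow> real \<Rightarrow> real" where
  "y_bar d u =
     (THE y. 0 < y \<and> y < real d * u * (1 - u) \<and> s_hat d u y \<le> 1 - u \<and> F_exp d u y = 0)"

definition A_exp :: "nat \<Rightarrow> real \<Rightarrow> real" where
  "A_exp d u = s_hat d u (y_bar d u) / u"

end

theory Submission
  imports Defs "HOL-Real_Asymp.Real_Asymp"
begin

text \<open>
The proof is a first-moment computation in the pairing model. A \<^emph>\<open>pairing\<close> is a perfect matching of
the \<open>d * n\<close> half-edges \<open>(v, i)\<close> with \<open>v < n\<close>, \<open>i < d\<close>; contracting the half-edges at each vertex gives a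
\<open>d\<close>-regular multigraph. Every simple regular graph arises from exactly \<open>fact d ^ n\<close> pairings
(\<open>card_simple_matchings_over\<close>), so an event fails in the random graph with at most its failure
probability for pairings divided by the probability that a pairing is simple. The latter is at least
the inverse of a polynomial in \<open>n\<close> (\<open>matching_number_le_simple\<close>): a random pairing has boundedly many
defects on average, and a defect can be switched away by a map with fibres of polynomial size. It
therefore suffices that pairings with a bad vertex set are exponentially rare.

Fix a set \<open>U\<close> of \<open>k = u * n\<close> vertices and let \<open>T\<close> be the set of half-edges outside \<open>U\<close> matched into \<open>U\<close>.
The number of pairings with a given \<open>T\<close> is bounded in terms of \<open>y = card T\<close> alone
(\<open>card_matchings_with_boundary\<close>), and the vertex boundary of \<open>U\<close> is the projection of \<open>T\<close>. Weighting
\<open>T\<close> by \<open>x ^ card T * z ^ card (fst ` T)\<close> with \<open>x > 0\<close> and \<open>0 < z \<le> 1\<close> gives a sum that factorises over the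
vertices (\<open>sum_fibre_weights\<close>); this is a Chernoff bound, in which \<open>x\<close> tracks the number \<open>y\<close> of
crossing pairs and \<open>z\<close> discards large boundaries. The resulting exponential rate is \<open>rate d l x z u y\<close>.

The point is that one fixed pair \<open>x\<close>, \<open>z\<close> works for all \<open>y\<close>: for \<open>u \<le> 1/2\<close> the rate is concave in \<open>y\<close>, so
with \<open>x = x_hat d u y0\<close> it is maximal at \<open>y0\<close> (\<open>rate_le_saddle\<close>). Choosing \<open>y0\<close> as the zero \<open>y_bar d u\<close> of
\<open>F_exp d u\<close>, and \<open>z\<close> by stationarity in the size of the boundary, the rate for \<open>l = A_exp d u\<close> at \<open>y0\<close> is
\<open>F_exp d u y0 = 0\<close> (\<open>rate_saddle\<close>). Since \<open>z < 1\<close>, lowering \<open>l\<close> below \<open>A_exp d u\<close> makes the rate strictly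
negative, uniformly in \<open>y\<close>, and by uniform continuity also for densities near the limit \<open>u0\<close>
(\<open>rate_uniformly_negative\<close>). That \<open>y_bar\<close> is well defined follows because \<open>F_exp d u\<close> is strictly
increasing: along the curve of points stationary in \<open>x\<close> and \<open>y\<close> its derivative is \<open>s'\<close> times
\<open>- ln z > 0\<close>.
\<close>

section \<open>Perfect matchings\<close>

definition perfect_matchings :: "'a set \<Rightarrow> 'a set set set" where
  "perfect_matchings X = {M. partition_on X M \<and> (\<forall>e\<in>M. card e = 2)}"

text \<open>The double factorial \<open>(m - 1)!!\<close> for even \<open>m\<close>, and \<open>0\<close> for odd \<open>m\<close>; the value \<open>0\<close> is what makes parity
conditions disappear from the later counts.\<close>

fun matching_number :: "nat \<Rightarrow> nat" where
  "matching_number 0 = 1"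
| "matching_number (Suc 0) = 0"
| "matching_number (Suc (Suc m)) = Suc m * matching_number m"

lemma finite_perfect_matchings: "finite X \<Longrightarrow> finite (perfect_matchings X)"
  unfolding perfect_matchings_def
  by (rule finite_subset[OF _ finitely_many_partition_on[of X]]) auto

lemma finite_perfect_matchings_Collect: "finite X \<Longrightarrow> finite {M \<in> perfect_matchings X. P M}"
  by (rule finite_subset[OF _ finite_perfect_matchings]) auto

lemma perfect_matchings_subset: "M \<in> perfect_matchings X \<Longrightarrow> M \<subseteq> nsets X 2"
  by (auto simp: perfect_matchings_def nsets_def partition_on_def intro: card_ge_0_finite)

lemma perfect_matching_unique:
  assumes "M \<in> perfect_matchings X" "e \<in> M" "e' \<in> M" "p \<in> e" "p \<in> e'"
  shows "e = e'"
  using assms by (auto simp: perfect_matchings_def partition_on_def disjoint_def)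

lemma perfect_matching_cover:
  assumes "M \<in> perfect_matchings X" "p \<in> X"
  obtains e where "e \<in> M" "p \<in> e"
  using assms by (auto simp: perfect_matchings_def partition_on_def)

text \<open>Removing a prescribed pair is the only recursion on matchings that is needed: the count of all
matchings, of matchings with a given boundary and of matchings containing given pairs, as well as the
switching operation, all come from it.\<close>

lemma perfect_matchings_insert:
  assumes "a \<in> X" "b \<in> X" "a \<noteq> b"
  shows "{M \<in> perfect_matchings X. {a, b} \<in> M} = insert {a, b} ` perfect_matchings (X - {a, b})"
proof (intro set_eqI iffI)
  fix M assume "M \<in> {M \<in> perfect_matchings X. {a, b} \<in> M}"
  hence M: "partition_on X M" "\<forall>e\<in>M. card e = 2" "{a, b} \<in> M"
    by (auto simp: perfect_matchings_def)
  define N where "N = M - {{a, b}}"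
  have MN: "M = insert {a, b} N" using M by (auto simp: N_def)
  have "disjnt {a, b} (\<Union>N)"
    using M unfolding N_def by (fastforce simp: partition_on_def disjoint_def disjnt_def)
  hence "partition_on (X - {a, b}) N"
    using M(1) partition_on_insert unfolding MN by blast
  hence "N \<in> perfect_matchings (X - {a, b})" using M unfolding perfect_matchings_def MN by auto
  thus "M \<in> insert {a, b} ` perfect_matchings (X - {a, b})" using MN by blast
next
  fix M assume "M \<in> insert {a, b} ` perfect_matchings (X - {a, b})"
  then obtain N where N: "partition_on (X - {a, b}) N" "\<forall>e\<in>N. card e = 2" "M = insert {a, b} N"
    by (auto simp: perfect_matchings_def)
  have "disjnt {a, b} (\<Union>N)" using partition_onD1[OF N(1)] by (auto simp: disjnt_def)
  hence "partition_on X M"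
    using partition_on_insert[of "{a, b}" N X] N assms by auto
  thus "M \<in> {M \<in> perfect_matchings X. {a, b} \<in> M}" using N assms by (auto simp: perfect_matchings_def)
qed

lemma insert_notin_perfect_matching:
  "N \<in> perfect_matchings (X - {a, b}) \<Longrightarrow> {a, b} \<notin> N"
  by (auto simp: perfect_matchings_def partition_on_def)

lemma inj_on_insert_perfect_matchings: "inj_on (insert {a, b}) (perfect_matchings (X - {a, b}))"
proof (rule inj_onI)
  fix M N assume "M \<in> perfect_matchings (X - {a, b})" "N \<in> perfect_matchings (X - {a, b})"
    "insert {a, b} M = insert {a, b} N"
  thus "M = N" using insert_notin_perfect_matching[of M X a b] insert_notin_perfect_matching[of N X a b]
    by (metis insert_ident)
qed

lemma card_perfect_matchings_insert:
  assumes "a \<in> X" "b \<in> X" "a \<noteq> b"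
  shows "card {M \<in> perfect_matchings X. {a, b} \<in> M} = card (perfect_matchings (X - {a, b}))"
  unfolding perfect_matchings_insert[OF assms] by (rule card_image[OF inj_on_insert_perfect_matchings])

lemma perfect_matching_partner:
  assumes "M \<in> perfect_matchings X" "a \<in> X"
  obtains b where "b \<in> X" "b \<noteq> a" "{a, b} \<in> M"
proof -
  obtain e where e: "e \<in> M" "a \<in> e" using perfect_matching_cover[OF assms] .
  have "e \<in> nsets X 2" using perfect_matchings_subset[OF assms(1)] e by auto
  then obtain x y where "e = {x, y}" "x \<in> X" "y \<in> X" "x \<noteq> y" by (auto simp: nsets_2_eq)
  thus ?thesis using that[of "if x = a then y else x"] e by (auto simp: insert_commute)
qed

lemma card_perfect_matchings:
  assumes "finite X"
  shows "card (perfect_matchings X) = matching_number (card X)"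
  using assms
proof (induction "card X" arbitrary: X rule: less_induct)
  case less
  show ?case
  proof (cases "X = {}")
    case True
    hence "perfect_matchings X = {{}}" by (auto simp: perfect_matchings_def partition_on_empty)
    thus ?thesis using True by simp
  next
    case False
    then obtain a where a: "a \<in> X" by auto
    have *: "perfect_matchings X = (\<Union>b\<in>X - {a}. {M \<in> perfect_matchings X. {a, b} \<in> M})"
      using perfect_matching_partner[OF _ a] by (auto; metis)
    have dj: "{M \<in> perfect_matchings X. {a, b} \<in> M} \<inter> {M \<in> perfect_matchings X. {a, c} \<in> M} = {}"
      if "b \<noteq> c" for b c
      using perfect_matching_unique[of _ X "{a, b}" "{a, c}" a] that by (auto simp: doubleton_eq_iff)
    have "card (perfect_matchings X) = (\<Sum>b\<in>X - {a}. card {M \<in> perfect_matchings X. {a, b} \<in> M})"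
      by (subst *, subst card_UN_disjoint)
        (use less.prems finite_perfect_matchings_Collect dj in auto)
    also have "\<dots> = (\<Sum>b\<in>X - {a}. matching_number (card X - 2))"
    proof (rule sum.cong[OF refl])
      fix b assume b: "b \<in> X - {a}"
      have c: "card (X - {a, b}) = card X - 2"
        using a b less.prems by (subst card_Diff_subset) auto
      have "card X \<noteq> 0" using a less.prems by auto
      hence "card (X - {a, b}) < card X" using c by linarith
      thus "card {M \<in> perfect_matchings X. {a, b} \<in> M} = matching_number (card X - 2)"
        using less.hyps[of "X - {a, b}"] less.prems a b c card_perfect_matchings_insert[of a X b]
        by auto
    qed
    also have "\<dots> = (card X - 1) * matching_number (card X - 2)" using a less.prems by simp
    also have "\<dots> = matching_number (card X)"
      using False less.prems by (cases "card X" rule: matching_number.cases) auto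
    finally show ?thesis .
  qed
qed

text \<open>Both this bound and the next come from \<open>fact m = (m - 1)!! * m!!\<close>, whose two factors are nearly equal.
They reduce estimates of matching numbers to estimates of factorials.\<close>

lemma matching_number_square_le_fact: "(matching_number m)\<^sup>2 \<le> fact m"
proof (induction m rule: matching_number.induct)
  case (3 m)
  have "(matching_number (Suc (Suc m)))\<^sup>2 = Suc m * Suc m * (matching_number m)\<^sup>2"
    by (simp add: power2_eq_square algebra_simps)
  also have "\<dots> \<le> Suc m * Suc (Suc m) * fact m"
    by (intro mult_mono) (use 3 in auto)
  also have "\<dots> = fact (Suc (Suc m))" by (simp only: fact_Suc of_nat_id mult_ac)
  finally show ?case .
qed auto

lemma fact_le_matching_number_square:
  "even m \<Longrightarrow> fact m \<le> Suc m * (matching_number m)\<^sup>2"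
proof (induction m rule: matching_number.induct)
  case (3 m)
  have "fact (Suc (Suc m)) = Suc (Suc m) * Suc m * fact m"
    by (simp only: fact_Suc of_nat_id mult_ac)
  also have "\<dots> \<le> Suc (Suc m) * Suc m * (Suc m * (matching_number m)\<^sup>2)"
    using 3 by (intro mult_left_mono) auto
  also have "\<dots> \<le> Suc (Suc (Suc m)) * Suc m * (Suc m * (matching_number m)\<^sup>2)"
    by (intro mult_right_mono) auto
  finally show ?case by (simp add: power2_eq_square algebra_simps)
qed auto

lemma matching_number_pos: "even m \<Longrightarrow> matching_number m > 0"
  by (induction m rule: matching_number.induct) auto

lemma card_matchings_without_crossing:
  assumes "finite A" "finite B" "A \<inter> B = {}"
  shows "card {M \<in> perfect_matchings (A \<union> B). vertex_boundary M A = {}}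
           \<le> matching_number (card A) * matching_number (card B)"
proof -
  let ?S = "{M \<in> perfect_matchings (A \<union> B). vertex_boundary M A = {}}"
  define r where "r M = ({e \<in> M. e \<subseteq> A}, {e \<in> M. e \<subseteq> B})" for M :: "'a set set"
  have split: "e \<subseteq> A \<or> e \<subseteq> B" if "M \<in> ?S" "e \<in> M" for M e
  proof -
    have "e \<in> nsets (A \<union> B) 2" using perfect_matchings_subset[of M] that by auto
    then obtain x y where "e = {x, y}" "x \<in> A \<union> B" "y \<in> A \<union> B" by (auto simp: nsets_2_eq)
    thus ?thesis using that by (auto simp: vertex_boundary_def insert_commute)
  qed
  have "inj_on r ?S"
  proof (rule inj_onI)
    fix M N assume "M \<in> ?S" "N \<in> ?S" "r M = r N"
    hence "{e \<in> M. e \<subseteq> A} = {e \<in> N. e \<subseteq> A}" "{e \<in> M. e \<subseteq> B} = {e \<in> N. e \<subseteq> B}"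
      by (auto simp: r_def)
    moreover have "M = {e \<in> M. e \<subseteq> A} \<union> {e \<in> M. e \<subseteq> B}" using split[OF \<open>M \<in> ?S\<close>] by blast
    moreover have "N = {e \<in> N. e \<subseteq> A} \<union> {e \<in> N. e \<subseteq> B}" using split[OF \<open>N \<in> ?S\<close>] by blast
    ultimately show "M = N" by argo
  qed
  moreover have "r ` ?S \<subseteq> perfect_matchings A \<times> perfect_matchings B"
  proof (intro image_subsetI)
    fix M assume M: "M \<in> ?S"
    have p: "\<Union>M = A \<union> B" "disjoint M" "{} \<notin> M" "\<forall>e\<in>M. card e = 2"
      using M by (auto simp: perfect_matchings_def partition_on_def)
    have cover: "\<exists>e\<in>M. a \<in> e" if "a \<in> A \<union> B" for a using p(1) that by blast
    have "\<Union>{e \<in> M. e \<subseteq> A} = A"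
    proof (intro equalityI subsetI)
      fix a assume a: "a \<in> A"
      then obtain e where "e \<in> M" "a \<in> e" using cover by blast
      moreover have "\<not> e \<subseteq> B" using a \<open>a \<in> e\<close> assms(3) by auto
      ultimately show "a \<in> \<Union>{e \<in> M. e \<subseteq> A}" using split[OF M, of e] by blast
    qed auto
    moreover have "\<Union>{e \<in> M. e \<subseteq> B} = B"
    proof (intro equalityI subsetI)
      fix b assume b: "b \<in> B"
      then obtain e where "e \<in> M" "b \<in> e" using cover by blast
      moreover have "\<not> e \<subseteq> A" using b \<open>b \<in> e\<close> assms(3) by auto
      ultimately show "b \<in> \<Union>{e \<in> M. e \<subseteq> B}" using split[OF M, of e] by blast
    qed auto
    ultimately show "r M \<in> perfect_matchings A \<times> perfect_matchings B"
      using p by (auto simp: r_def perfect_matchings_def partition_on_def disjoint_def)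
  qed
  ultimately have "card ?S \<le> card (perfect_matchings A \<times> perfect_matchings B)"
    using assms by (meson card_inj_on_le finite_SigmaI finite_perfect_matchings)
  thus ?thesis using assms by (simp add: card_cartesian_product card_perfect_matchings)
qed

text \<open>For a matching in which \<open>T\<close> is exactly the part of \<open>B\<close> matched into \<open>A\<close>, the partners of \<open>T\<close> can be chosen
one after another, and the rest of \<open>A\<close> and the rest of \<open>B\<close> are matched separately. If \<open>T\<close> is larger than
\<open>A\<close>, truncated subtraction puts a factor \<open>0\<close> into the product.\<close>

lemma card_matchings_with_boundary:
  assumes "finite A" "finite B" "A \<inter> B = {}" "T \<subseteq> B"
  shows "card {M \<in> perfect_matchings (A \<union> B). vertex_boundary M A = T}
           \<le> (\<Prod>i<card T. card A - i) * matching_number (card A - card T)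
               * matching_number (card B - card T)"
proof -
  have "finite T" using assms finite_subset by auto
  from this assms show ?thesis
  proof (induction T arbitrary: A B rule: finite_induct)
    case empty
    thus ?case using card_matchings_without_crossing[of A B] by simp
  next
    case (insert t T)
    let ?S = "{M \<in> perfect_matchings (A \<union> B). vertex_boundary M A = insert t T}"
    let ?S' = "\<lambda>a. {M \<in> perfect_matchings ((A - {a}) \<union> (B - {t})). vertex_boundary M (A - {a}) = T}"
    let ?w = "(\<Prod>i<card T. card A - 1 - i) * matching_number (card A - 1 - card T)
               * matching_number (card B - 1 - card T)"
    have t: "t \<in> B" "t \<notin> A" using insert by auto
    have sub: "?S \<subseteq> (\<Union>a\<in>A. insert {a, t} ` ?S' a)"
    proof
      fix M assume M: "M \<in> ?S"
      then obtain a where a: "a \<in> A" "{a, t} \<in> M" by (auto simp: vertex_boundary_def)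
      have "M \<in> insert {a, t} ` perfect_matchings ((A \<union> B) - {a, t})"
        using perfect_matchings_insert[of a "A \<union> B" t] M a t by blast
      then obtain N where N: "M = insert {a, t} N" "N \<in> perfect_matchings ((A \<union> B) - {a, t})" by auto
      have e: "(A \<union> B) - {a, t} = (A - {a}) \<union> (B - {t})" using a t insert.prems by auto
      have sb: "N \<subseteq> nsets ((A \<union> B) - {a, t}) 2" using perfect_matchings_subset[OF N(2)] .
      have "vertex_boundary N (A - {a}) = vertex_boundary M A - {t}"
      proof -
        have 1: "w \<noteq> a" "w \<noteq> t" "v \<noteq> a" if "{v, w} \<in> N" for v w
          using sb that by auto
        show ?thesis
        proof (intro set_eqI iffI)
          fix w assume "w \<in> vertex_boundary N (A - {a})"
          then obtain v where v: "v \<in> A" "{v, w} \<in> N" "w \<notin> A - {a}" by (auto simp: vertex_boundary_def)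
          thus "w \<in> vertex_boundary M A - {t}" using 1[OF v(2)] N(1) by (auto simp: vertex_boundary_def)
        next
          fix w assume "w \<in> vertex_boundary M A - {t}"
          then obtain v where v: "v \<in> A" "{v, w} \<in> M" "w \<notin> A" "w \<noteq> t" by (auto simp: vertex_boundary_def)
          hence "{v, w} \<in> N" using N(1) t a by (auto simp: doubleton_eq_iff)
          thus "w \<in> vertex_boundary N (A - {a})" using v 1[of v w] by (auto simp: vertex_boundary_def)
        qed
      qed
      hence "vertex_boundary N (A - {a}) = T" using M insert.hyps by auto
      hence "M \<in> insert {a, t} ` ?S' a" using N unfolding e by blast
      thus "M \<in> (\<Union>a\<in>A. insert {a, t} ` ?S' a)" using a by auto
    qed
    have "card ?S \<le> card (\<Union>a\<in>A. insert {a, t} ` ?S' a)"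
      using insert.prems by (intro card_mono[OF _ sub]) (auto intro!: finite_perfect_matchings_Collect)
    also have "\<dots> \<le> (\<Sum>a\<in>A. card (insert {a, t} ` ?S' a))" using insert.prems by (intro card_UN_le) auto
    also have "\<dots> \<le> (\<Sum>a\<in>A. ?w)"
    proof (rule sum_mono)
      fix a assume a: "a \<in> A"
      have "card (insert {a, t} ` ?S' a) \<le> card (?S' a)"
        using insert.prems by (intro card_image_le) (auto intro!: finite_perfect_matchings_Collect)
      also have "\<dots> \<le> (\<Prod>i<card T. card (A - {a}) - i) * matching_number (card (A - {a}) - card T)
               * matching_number (card (B - {t}) - card T)"
        using insert by (intro insert.IH) auto
      also have "\<dots> = ?w" using a t insert.prems by simp
      finally show "card (insert {a, t} ` ?S' a) \<le> ?w" .
    qed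
    also have "\<dots> = (\<Prod>i<card (insert t T). card A - i) * matching_number (card A - card (insert t T))
               * matching_number (card B - card (insert t T))"
      using insert.hyps by (simp add: prod.lessThan_Suc_shift del: prod.lessThan_Suc)
    finally show ?case .
  qed
qed

section \<open>The first moment in the pairing model\<close>

lemma sum_subsets_power:
  fixes x :: real
  assumes "finite D"
  shows "(\<Sum>T\<in>Pow D. x ^ card T) = (1 + x) ^ card D"
proof -
  have "(\<Prod>i\<in>D. x + 1) = (\<Sum>T\<in>Pow D. (\<Prod>i\<in>T. x) * (\<Prod>i\<in>D - T. 1))"
    using prod_add[OF assms, of "\<lambda>_. x" "\<lambda>_. 1"] by simp
  thus ?thesis by (simp add: add.commute)
qed

text \<open>Choosing \<open>T \<subseteq> W \<times> D\<close> means choosing the fibre of \<open>T\<close> above each element of \<open>W\<close> independently. An empty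
fibre contributes \<open>1\<close>, and the nonempty ones contribute \<open>z * ((1 + x) ^ card D - 1)\<close> in total.\<close>

lemma sum_fibre_weights:
  fixes x z :: real
  assumes "finite W" "finite D"
  shows "(\<Sum>T\<in>Pow (W \<times> D). x ^ card T * z ^ card (fst ` T))
           = (1 + z * ((1 + x) ^ card D - 1)) ^ card W"
  using assms(1)
proof (induction W rule: finite_induct)
  case (insert v W)
  \<comment> \<open>A subset of \<open>insert v W \<times> D\<close> is its fibre \<open>S\<close> above \<open>v\<close> together with the part \<open>T\<close> above \<open>W\<close>.\<close>
  define h where "h = (\<lambda>(S, T). Pair v ` S \<union> T :: ('a \<times> 'b) set)"
  have inj: "inj_on h (Pow D \<times> Pow (W \<times> D))"
  proof (rule inj_on_inverseI)
    fix q assume "q \<in> Pow D \<times> Pow (W \<times> D)"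
    thus "(\<lambda>R. ({i. (v, i) \<in> R}, R - {v} \<times> UNIV)) (h q) = q"
      using insert.hyps by (cases q) (auto simp: h_def)
  qed
  have img: "Pow (insert v W \<times> D) = h ` (Pow D \<times> Pow (W \<times> D))"
  proof (intro equalityI subsetI)
    fix R assume "R \<in> Pow (insert v W \<times> D)"
    hence "R = h ({i. (v, i) \<in> R}, R - {v} \<times> UNIV)"
      "({i. (v, i) \<in> R}, R - {v} \<times> UNIV) \<in> Pow D \<times> Pow (W \<times> D)"
      by (auto simp: h_def)
    thus "R \<in> h ` (Pow D \<times> Pow (W \<times> D))" by blast
  qed (auto simp: h_def)
  let ?c = "\<lambda>S. if S = {} then 1 else z"
  have weight: "x ^ card (h (S, T)) * z ^ card (fst ` h (S, T))
      = (x ^ card S * ?c S) * (x ^ card T * z ^ card (fst ` T))"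
    if "S \<subseteq> D" "T \<subseteq> W \<times> D" for S T
  proof -
    have fin: "finite S" "finite T" using that assms(2) insert.hyps by (auto intro: finite_subset)
    have "card (h (S, T)) = card S + card T"
      unfolding h_def using fin that insert.hyps
      by (subst prod.case, subst card_Un_disjoint) (auto simp: card_image inj_on_def)
    moreover have "card (fst ` h (S, T)) = (if S = {} then 0 else 1) + card (fst ` T)"
    proof -
      have "fst ` h (S, T) = (if S = {} then {} else {v}) \<union> fst ` T"
        by (force simp: h_def)
      moreover have "v \<notin> fst ` T" using that insert.hyps by auto
      ultimately show ?thesis using fin by auto
    qed
    ultimately show ?thesis by (simp add: power_add)
  qed
  have "(\<Sum>S\<in>Pow D. x ^ card S * ?c S) = 1 + (\<Sum>S\<in>Pow D - {{}}. x ^ card S * z)"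
    using assms(2) by (subst sum.remove[of _ "{}"]) (auto intro!: sum.cong)
  also have "\<dots> = 1 + z * ((\<Sum>S\<in>Pow D. x ^ card S) - 1)"
    using assms(2) by (subst (2) sum.remove[of _ "{}"]) (auto simp: sum_distrib_left mult.commute)
  finally have one: "(\<Sum>S\<in>Pow D. x ^ card S * ?c S) = 1 + z * ((1 + x) ^ card D - 1)"
    using sum_subsets_power[OF assms(2)] by simp
  have "(\<Sum>R\<in>Pow (insert v W \<times> D). x ^ card R * z ^ card (fst ` R))
      = (\<Sum>(S, T)\<in>Pow D \<times> Pow (W \<times> D). (x ^ card S * ?c S) * (x ^ card T * z ^ card (fst ` T)))"
    unfolding img by (subst sum.reindex[OF inj]) (auto intro!: sum.cong simp: weight)
  also have "\<dots> = (\<Sum>S\<in>Pow D. x ^ card S * ?c S) * (\<Sum>T\<in>Pow (W \<times> D). x ^ card T * z ^ card (fst ` T))"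
    by (simp only: sum_product sum.cartesian_product)
  also have "\<dots> = (1 + z * ((1 + x) ^ card D - 1)) ^ card (insert v W)"
    unfolding one insert.IH using insert.hyps by simp
  finally show ?case .
qed simp

definition half_edges :: "nat \<Rightarrow> nat \<Rightarrow> (nat \<times> nat) set" where
  "half_edges n d = {..<n} \<times> {..<d}"

lemma finite_half_edges: "finite (half_edges n d)"
  and card_half_edges: "card (half_edges n d) = d * n"
  by (auto simp: half_edges_def card_cartesian_product mult.commute)

text \<open>The boundary is taken in the matching on half-edges and then projected to vertices, so that the
definition makes sense for pairings that are not simple.\<close>

definition poorly_expanding :: "nat \<Rightarrow> nat \<Rightarrow> nat \<Rightarrow> real \<Rightarrow> (nat \<times> nat) set set set" where
  "poorly_expanding n d k b = {M \<in> perfect_matchings (half_edges n d).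
     \<exists>U\<subseteq>{..<n}. card U = k \<and> real (card (fst ` vertex_boundary M (U \<times> {..<d}))) < b}"

text \<open>The bound of \<open>card_matchings_with_boundary\<close> for a block of \<open>a\<close> and a block of \<open>b\<close> half-edges joined by \<open>y\<close>
pairs.\<close>

definition crossing_weight :: "nat \<Rightarrow> nat \<Rightarrow> nat \<Rightarrow> nat" where
  "crossing_weight a b y = (\<Prod>i<y. a - i) * matching_number (a - y) * matching_number (b - y)"

text \<open>Chernoff bound: a set \<open>T\<close> whose projection has fewer than \<open>b\<close> elements satisfies
\<open>z powr (card (fst ` T) - b) \<ge> 1\<close> because \<open>z \<le> 1\<close>. The sum over these \<open>T\<close> can then be extended to all \<open>T\<close>
and evaluated by \<open>sum_fibre_weights\<close>.\<close>

lemma card_poorly_expanding_set: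
  fixes x z b w :: real
  assumes "U \<subseteq> {..<n}" "card U = k" "0 < x" "0 < z" "z \<le> 1"
    and w: "\<And>y. y \<le> d * k \<Longrightarrow> y \<le> d * (n - k) \<Longrightarrow> real (crossing_weight (d * k) (d * (n - k)) y) \<le> w * x ^ y"
  shows "real (card {M \<in> perfect_matchings (half_edges n d).
           real (card (fst ` vertex_boundary M (U \<times> {..<d}))) < b})
       \<le> w * z powr (- b) * (1 + z * ((1 + x) ^ d - 1)) ^ (n - k)"
proof -
  define W where "W = {..<n} - U"
  let ?A = "U \<times> {..<d}" and ?B = "W \<times> {..<d}"
  have fU: "finite U" using assms(1) finite_subset by blast
  have cW: "card W = n - k" using assms(1,2) fU by (simp add: W_def card_Diff_subset)
  have X: "half_edges n d = ?A \<union> ?B" using assms(1) by (auto simp: half_edges_def W_def)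
  have cA: "card ?A = d * k" and cB: "card ?B = d * (n - k)"
    using assms(2) cW by (auto simp: card_cartesian_product)
  have fin: "finite ?A" "finite ?B" using fU by (auto simp: W_def)
  have dj: "?A \<inter> ?B = {}" by (auto simp: W_def)
  let ?P = "\<lambda>T. {M \<in> perfect_matchings (?A \<union> ?B). vertex_boundary M ?A = T}"
  let ?S = "{M \<in> perfect_matchings (half_edges n d). real (card (fst ` vertex_boundary M ?A)) < b}"
  let ?TT = "{T \<in> Pow ?B. real (card (fst ` T)) < b}"
  have w0: "0 \<le> w" using w[of 0] of_nat_0_le_iff[of "crossing_weight (d * k) (d * (n - k)) 0"]
    by (simp del: of_nat_0_le_iff)
  have sub: "?S \<subseteq> (\<Union>T\<in>?TT. ?P T)"
  proof
    fix M assume M: "M \<in> ?S"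
    have "vertex_boundary M ?A \<subseteq> ?B"
    proof
      fix q assume "q \<in> vertex_boundary M ?A"
      then obtain p where "p \<in> ?A" "{p, q} \<in> M" "q \<notin> ?A" by (auto simp: vertex_boundary_def)
      moreover have "{p, q} \<in> nsets (half_edges n d) 2"
        using perfect_matchings_subset[of M] M \<open>{p, q} \<in> M\<close> by blast
      ultimately show "q \<in> ?B" unfolding X by auto
    qed
    thus "M \<in> (\<Union>T\<in>?TT. ?P T)" using M unfolding X by blast
  qed
  have bound: "real (card (?P T)) \<le> w * x ^ card T" if "T \<subseteq> ?B" for T
  proof -
    have le: "card T \<le> d * (n - k)" using card_mono[OF fin(2) that] cB by simp
    have "card (?P T) \<le> crossing_weight (d * k) (d * (n - k)) (card T)"
      using card_matchings_with_boundary[OF fin dj that] unfolding cA cB crossing_weight_def .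
    hence *: "real (card (?P T)) \<le> real (crossing_weight (d * k) (d * (n - k)) (card T))" by simp
    show ?thesis
    proof (cases "card T \<le> d * k")
      case True
      thus ?thesis using * w[OF True le] by linarith
    next
      case False
      hence "crossing_weight (d * k) (d * (n - k)) (card T) = 0"
        by (auto simp: crossing_weight_def intro!: bexI[of _ "d * k"])
      thus ?thesis using * w0 assms(3) by simp
    qed
  qed
  have "real (card ?S) \<le> real (card (\<Union>T\<in>?TT. ?P T))"
    using fin by (intro of_nat_mono card_mono[OF _ sub]) (auto intro!: finite_perfect_matchings_Collect)
  also have "\<dots> \<le> real (\<Sum>T\<in>?TT. card (?P T))" using fin by (intro of_nat_mono card_UN_le) auto
  also have "\<dots> \<le> (\<Sum>T\<in>?TT. w * x ^ card T)" unfolding of_nat_sum by (intro sum_mono bound) auto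
  also have "\<dots> \<le> (\<Sum>T\<in>?TT. w * z powr (- b) * (x ^ card T * z ^ card (fst ` T)))"
  proof (rule sum_mono)
    fix T assume T: "T \<in> ?TT"
    have "1 \<le> z powr (real (card (fst ` T)) - b)"
      using T assms by (auto simp: powr_def intro!: mult_nonpos_nonpos)
    also have "\<dots> = z powr (- b) * z ^ card (fst ` T)"
      using assms by (simp add: powr_diff powr_minus powr_realpow field_simps)
    finally have "w * x ^ card T * 1 \<le> w * x ^ card T * (z powr (- b) * z ^ card (fst ` T))"
      using w0 assms by (intro mult_left_mono) auto
    thus "w * x ^ card T \<le> w * z powr (- b) * (x ^ card T * z ^ card (fst ` T))"
      by (simp add: mult_ac)
  qed
  also have "\<dots> \<le> (\<Sum>T\<in>Pow ?B. w * z powr (- b) * (x ^ card T * z ^ card (fst ` T)))"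
    using w0 assms fin by (intro sum_mono2) auto
  also have "\<dots> = w * z powr (- b) * (1 + z * ((1 + x) ^ d - 1)) ^ (n - k)"
    unfolding sum_distrib_left[symmetric] using fU
    by (subst sum_fibre_weights) (auto simp: W_def cW[unfolded W_def])
  finally show ?thesis .
qed

lemma card_poorly_expanding:
  fixes x z b w :: real
  assumes "0 < x" "0 < z" "z \<le> 1"
    and w: "\<And>y. y \<le> d * k \<Longrightarrow> y \<le> d * (n - k) \<Longrightarrow> real (crossing_weight (d * k) (d * (n - k)) y) \<le> w * x ^ y"
  shows "real (card (poorly_expanding n d k b))
       \<le> real (n choose k) * (w * z powr (- b) * (1 + z * ((1 + x) ^ d - 1)) ^ (n - k))"
proof -
  let ?UU = "{U. U \<subseteq> {..<n} \<and> card U = k}"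
  let ?P = "\<lambda>U. {M \<in> perfect_matchings (half_edges n d).
           real (card (fst ` vertex_boundary M (U \<times> {..<d}))) < b}"
  have "poorly_expanding n d k b \<subseteq> (\<Union>U\<in>?UU. ?P U)" by (auto simp: poorly_expanding_def)
  hence "card (poorly_expanding n d k b) \<le> card (\<Union>U\<in>?UU. ?P U)"
    by (intro card_mono) (auto intro!: finite_perfect_matchings_Collect finite_half_edges)
  also have "\<dots> \<le> (\<Sum>U\<in>?UU. card (?P U))" by (intro card_UN_le) auto
  finally have "real (card (poorly_expanding n d k b)) \<le> (\<Sum>U\<in>?UU. real (card (?P U)))"
    using of_nat_mono by fastforce
  also have "\<dots> \<le> (\<Sum>U\<in>?UU. w * z powr (- b) * (1 + z * ((1 + x) ^ d - 1)) ^ (n - k))"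
    by (intro sum_mono card_poorly_expanding_set[OF _ _ assms(1-3) w]) auto
  also have "\<dots> = real (n choose k) * (w * z powr (- b) * (1 + z * ((1 + x) ^ d - 1)) ^ (n - k))"
    using n_subsets[of "{..<n}" k] by simp
  finally show ?thesis .
qed

section \<open>From pairings to simple regular graphs\<close>

definition simple_matchings :: "nat \<Rightarrow> nat \<Rightarrow> (nat \<times> nat) set set set" where
  "simple_matchings n d = {M \<in> perfect_matchings (half_edges n d).
     (\<forall>p\<in>M. inj_on fst p) \<and> inj_on ((`) fst) M}"

abbreviation underlying_graph :: "('a \<times> 'b) set set \<Rightarrow> 'a set set" where
  "underlying_graph M \<equiv> (`) fst ` M"

lemma finite_simple_matchings: "finite (simple_matchings n d)"
  unfolding simple_matchings_def by (intro finite_perfect_matchings_Collect finite_half_edges)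

lemma finite_regular_graphs: "finite (regular_graphs n d)"
  by (rule finite_subset[of _ "Pow (nsets {..<n} 2)"])
    (auto simp: regular_graphs_def finite_imp_finite_nsets)

lemma underlying_graph_regular:
  assumes "M \<in> simple_matchings n d"
  shows "underlying_graph M \<in> regular_graphs n d"
proof -
  have M: "M \<in> perfect_matchings (half_edges n d)" "\<And>p. p \<in> M \<Longrightarrow> inj_on fst p" "inj_on ((`) fst) M"
    using assms by (auto simp: simple_matchings_def)
  have "fst ` p \<in> nsets {..<n} 2" if "p \<in> M" for p
  proof -
    have "p \<in> nsets (half_edges n d) 2" using perfect_matchings_subset[OF M(1)] that by auto
    thus ?thesis using M(2)[OF that] by (auto simp: nsets_def half_edges_def card_image)
  qed
  moreover have "card {e \<in> underlying_graph M. v \<in> e} = d" if v: "v < n" for v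
  proof -
    have "\<forall>i. \<exists>p. i < d \<longrightarrow> p \<in> M \<and> (v, i) \<in> p"
      using perfect_matching_cover[OF M(1), of "(v, _)"] v by (force simp: half_edges_def)
    from choice[OF this] obtain p where p: "\<And>i. i < d \<Longrightarrow> p i \<in> M \<and> (v, i) \<in> p i" by blast
    have "bij_betw (\<lambda>i. fst ` p i) {..<d} {e \<in> underlying_graph M. v \<in> e}"
      unfolding bij_betw_def
    proof (intro conjI inj_onI equalityI subsetI)
      fix i j assume ij: "i \<in> {..<d}" "j \<in> {..<d}" "fst ` p i = fst ` p j"
      hence "p i \<in> M" "p j \<in> M" using p by auto
      hence "p i = p j" using inj_onD[OF M(3) ij(3)] by simp
      hence "(v, i) \<in> p i" "(v, j) \<in> p i" "p i \<in> M" using p[of i] p[of j] ij by auto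
      thus "i = j" using inj_onD[OF M(2), of "p i" "(v, i)" "(v, j)"] by simp
    next
      fix e assume "e \<in> (\<lambda>i. fst ` p i) ` {..<d}"
      thus "e \<in> {e \<in> underlying_graph M. v \<in> e}" using p by force
    next
      fix e assume "e \<in> {e \<in> underlying_graph M. v \<in> e}"
      then obtain q i where q: "q \<in> M" "e = fst ` q" "(v, i) \<in> q" by auto
      have "i < d" using perfect_matchings_subset[OF M(1)] q by (auto simp: nsets_def half_edges_def)
      hence "p i = q" using p[of i] q perfect_matching_unique[OF M(1), of "p i" q "(v, i)"] by auto
      thus "e \<in> (\<lambda>i. fst ` p i) ` {..<d}" using q \<open>i < d\<close> by auto
    qed
    hence "card {..<d} = card {e \<in> underlying_graph M. v \<in> e}" by (rule bij_betw_same_card)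
    thus ?thesis by simp
  qed
  ultimately show ?thesis by (auto simp: regular_graphs_def)
qed

lemma vertex_boundary_underlying_graph:
  assumes "M \<in> perfect_matchings (half_edges n d)" "\<And>p. p \<in> M \<Longrightarrow> inj_on fst p"
  shows "vertex_boundary (underlying_graph M) U = fst ` vertex_boundary M (U \<times> {..<d})"
proof (intro equalityI subsetI)
  fix w assume "w \<in> vertex_boundary (underlying_graph M) U"
  then obtain v p where p: "v \<in> U" "w \<notin> U" "p \<in> M" "fst ` p = {v, w}"
    by (auto simp: vertex_boundary_def; metis)
  have "p \<in> nsets (half_edges n d) 2" using perfect_matchings_subset[OF assms(1)] p by auto
  then obtain a b where ab: "p = {a, b}" "a \<in> half_edges n d" "b \<in> half_edges n d" "fst a = v" "fst b = w"
    using p(4) by (auto simp: nsets_2_eq doubleton_eq_iff; metis insert_commute)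
  have "b \<in> vertex_boundary M (U \<times> {..<d})"
    using ab p unfolding vertex_boundary_def
    by (cases a; cases b) (auto simp: half_edges_def intro!: bexI[of _ a])
  thus "w \<in> fst ` vertex_boundary M (U \<times> {..<d})" using ab by blast
next
  fix w assume "w \<in> fst ` vertex_boundary M (U \<times> {..<d})"
  then obtain a b where ab: "a \<in> U \<times> {..<d}" "{a, b} \<in> M" "b \<notin> U \<times> {..<d}" "w = fst b"
    by (auto simp: vertex_boundary_def)
  have "{a, b} \<in> nsets (half_edges n d) 2" using perfect_matchings_subset[OF assms(1)] ab by auto
  hence "snd b < d" by (auto simp: half_edges_def)
  hence "w \<notin> U" using ab by (cases b) auto
  moreover have "{fst a, fst b} \<in> underlying_graph M" using ab(2) by (rule rev_image_eqI) auto
  moreover have "fst a \<in> U" using ab by auto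
  ultimately show "w \<in> vertex_boundary (underlying_graph M) U"
    using ab by (auto simp: vertex_boundary_def)
qed

text \<open>The pairing obtained from a graph when every vertex \<open>v\<close> numbers its incident edges by \<open>\<beta> v\<close>.\<close>

definition attach_labels :: "'a set set \<Rightarrow> ('a \<Rightarrow> 'a set \<Rightarrow> 'b) \<Rightarrow> ('a \<times> 'b) set set" where
  "attach_labels E \<beta> = (\<lambda>e. (\<lambda>v. (v, \<beta> v e)) ` e) ` E"

lemma underlying_attach_labels: "fst ` (\<lambda>v. (v, \<beta> v e)) ` e = e"
  by (simp add: image_image)

text \<open>A simple pairing over \<open>E\<close> is the same as a numbering of the incident edges by \<open>{..<d}\<close> at each vertex, and
each of the \<open>n\<close> vertices has \<open>fact d\<close> such numberings. That the fibres all have the same size is what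
transfers the uniform distribution from simple pairings to simple graphs.\<close>

lemma card_simple_matchings_over:
  assumes E: "E \<in> regular_graphs n d"
  shows "card {M \<in> simple_matchings n d. underlying_graph M = E} = fact d ^ n"
proof -
  let ?Ev = "\<lambda>v. {e \<in> E. v \<in> e}"
  let ?L = "PiE {..<n} (\<lambda>v. {f \<in> ?Ev v \<rightarrow>\<^sub>E {..<d}. inj_on f (?Ev v)})"
  have Esub: "E \<subseteq> nsets {..<n} 2" and deg: "\<And>v. v < n \<Longrightarrow> card (?Ev v) = d"
    using E by (auto simp: regular_graphs_def)
  have finE: "finite E" using Esub finite_subset finite_imp_finite_nsets by blast
  have en: "v < n" if "e \<in> E" "v \<in> e" for v e using that Esub by (auto simp: nsets_def)
  have bij: "bij_betw (\<beta> v) (?Ev v) {..<d}" if "\<beta> \<in> ?L" "v < n" for \<beta> v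
  proof -
    have "\<beta> v \<in> {f \<in> ?Ev v \<rightarrow>\<^sub>E {..<d}. inj_on f (?Ev v)}"
      using PiE_mem[OF that(1), of v] that(2) by simp
    hence "inj_on (\<beta> v) (?Ev v)" "\<beta> v ` ?Ev v \<subseteq> {..<d}" by (auto simp: PiE_iff)
    moreover from this have "card (\<beta> v ` ?Ev v) = card {..<d}"
      using deg[OF that(2)] by (simp add: card_image)
    ultimately show ?thesis using card_subset_eq[of "{..<d}" "\<beta> v ` ?Ev v"] by (simp add: bij_betw_def)
  qed
  have "bij_betw (attach_labels E) ?L {M \<in> simple_matchings n d. underlying_graph M = E}"
    unfolding bij_betw_def
  proof (intro conjI equalityI image_subsetI inj_onI)
    fix \<beta> assume \<beta>: "\<beta> \<in> ?L"
    let ?M = "attach_labels E \<beta>"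
    have "partition_on (half_edges n d) ?M"
    proof (rule partition_onI)
      show "\<Union>?M = half_edges n d"
      proof (intro equalityI subsetI)
        fix q assume "q \<in> \<Union>?M"
        then obtain e v where "e \<in> E" "v \<in> e" "q = (v, \<beta> v e)" by (auto simp: attach_labels_def)
        thus "q \<in> half_edges n d"
          using bij_betwE[OF bij[OF \<beta> en[of e v]]] en[of e v] by (auto simp: half_edges_def)
      next
        fix q assume "q \<in> half_edges n d"
        then obtain v i where q: "q = (v, i)" "v < n" "i < d" by (auto simp: half_edges_def)
        then obtain e where "e \<in> ?Ev v" "\<beta> v e = i"
          using bij[OF \<beta> q(2)] unfolding bij_betw_def by (metis (no_types, lifting) imageE lessThan_iff)
        thus "q \<in> \<Union>?M" using q by (auto simp: attach_labels_def)
      qed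
      show "{} \<notin> ?M" using Esub by (auto simp: attach_labels_def nsets_def)
      fix p q assume pq: "p \<in> ?M" "q \<in> ?M" "p \<noteq> q"
      then obtain e f where ef: "e \<in> E" "f \<in> E" "p = (\<lambda>v. (v, \<beta> v e)) ` e" "q = (\<lambda>v. (v, \<beta> v f)) ` f"
        by (auto simp: attach_labels_def)
      have False if "t \<in> p" "t \<in> q" for t
      proof -
        from that ef obtain v where v: "v \<in> e" "v \<in> f" "\<beta> v e = \<beta> v f" by auto
        hence "e = f" using bij[OF \<beta> en[OF ef(1) v(1)]] ef by (auto simp: bij_betw_def dest: inj_onD)
        thus False using pq ef by simp
      qed
      thus "disjnt p q" by (auto simp: disjnt_def)
    qed
    moreover have "card p = 2" if "p \<in> ?M" for p
      using that Esub by (auto simp: attach_labels_def nsets_def card_image inj_on_def)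
    moreover have "inj_on fst p" if "p \<in> ?M" for p using that by (auto simp: attach_labels_def inj_on_def)
    moreover have "inj_on ((`) fst) ?M"
      by (rule inj_onI) (auto simp: attach_labels_def underlying_attach_labels)
    moreover have "underlying_graph ?M = E"
      by (simp add: attach_labels_def image_image)
    ultimately show "?M \<in> {M \<in> simple_matchings n d. underlying_graph M = E}"
      by (auto simp: simple_matchings_def perfect_matchings_def)
  next
    fix \<beta> \<gamma> assume \<beta>: "\<beta> \<in> ?L" and \<gamma>: "\<gamma> \<in> ?L" and eq: "attach_labels E \<beta> = attach_labels E \<gamma>"
    have *: "\<beta> v e = \<gamma> v e" if "e \<in> E" "v \<in> e" for e v
    proof -
      have "(\<lambda>v. (v, \<beta> v e)) ` e \<in> attach_labels E \<gamma>"
        unfolding eq[symmetric] using that by (auto simp: attach_labels_def)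
      then obtain f where f: "(\<lambda>v. (v, \<beta> v e)) ` e = (\<lambda>v. (v, \<gamma> v f)) ` f" by (auto simp: attach_labels_def)
      hence "e = f" using underlying_attach_labels[of \<beta> e] underlying_attach_labels[of \<gamma> f] by simp
      thus ?thesis using f that by auto
    qed
    show "\<beta> = \<gamma>"
    proof (rule PiE_ext[OF \<beta> \<gamma>])
      fix v assume v: "v \<in> {..<n}"
      have "\<beta> v \<in> ?Ev v \<rightarrow>\<^sub>E {..<d}" "\<gamma> v \<in> ?Ev v \<rightarrow>\<^sub>E {..<d}"
        using PiE_mem[OF \<beta> v] PiE_mem[OF \<gamma> v] by auto
      thus "\<beta> v = \<gamma> v" by (rule PiE_ext) (use * in auto)
    qed
  next
    show "{M \<in> simple_matchings n d. underlying_graph M = E} \<subseteq> attach_labels E ` ?L"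
    proof
      fix M assume "M \<in> {M \<in> simple_matchings n d. underlying_graph M = E}"
      hence M: "M \<in> perfect_matchings (half_edges n d)" "\<And>p. p \<in> M \<Longrightarrow> inj_on fst p" "inj_on ((`) fst) M"
        "underlying_graph M = E" by (auto simp: simple_matchings_def)
      define P where "P = inv_into M ((`) fst)"
      have P: "P e \<in> M \<and> fst ` P e = e" if "e \<in> E" for e
        unfolding P_def using that M(4) inv_into_into[of e "(`) fst" M] f_inv_into_f[of e "(`) fst" M]
        by blast
      define b where "b v e = (SOME i. (v, i) \<in> P e)" for v e
      have b: "(v, b v e) \<in> P e" if "e \<in> E" "v \<in> e" for v e
      proof -
        have "v \<in> fst ` P e" using P that by simp
        hence "\<exists>i. (v, i) \<in> P e" by auto
        thus ?thesis unfolding b_def by (rule someI_ex)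
      qed
      define \<beta> where "\<beta> = (\<lambda>v\<in>{..<n}. \<lambda>e\<in>?Ev v. b v e)"
      have \<beta>b: "\<beta> v e = b v e" if "e \<in> E" "v \<in> e" for v e using that en by (auto simp: \<beta>_def)
      have img: "(\<lambda>v. (v, \<beta> v e)) ` e = P e" if e: "e \<in> E" for e
      proof (intro equalityI subsetI)
        fix q assume "q \<in> (\<lambda>v. (v, \<beta> v e)) ` e"
        thus "q \<in> P e" using b e \<beta>b by auto
      next
        fix q assume q: "q \<in> P e"
        hence "fst q \<in> e" using P[OF e] by blast
        hence "(fst q, b (fst q) e) \<in> P e" using b e by auto
        hence "q = (fst q, b (fst q) e)"
          using q inj_onD[OF M(2)[of "P e"], of q "(fst q, b (fst q) e)"] P[OF e] by simp
        hence "q = (fst q, \<beta> (fst q) e)" using \<beta>b[OF e \<open>fst q \<in> e\<close>] by simp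
        thus "q \<in> (\<lambda>v. (v, \<beta> v e)) ` e" using \<open>fst q \<in> e\<close> by (rule image_eqI)
      qed
      have "attach_labels E \<beta> = P ` E" unfolding attach_labels_def using img by auto
      also have "\<dots> = M"
      proof (intro equalityI subsetI)
        fix q assume "q \<in> M"
        hence "fst ` q \<in> E" using M(4) by auto
        hence "P (fst ` q) = q" using P[of "fst ` q"] inj_onD[OF M(3)] \<open>q \<in> M\<close> by blast
        thus "q \<in> P ` E" using \<open>fst ` q \<in> E\<close> by (intro image_eqI[of _ _ "fst ` q"]) simp_all
      qed (use P in auto)
      finally have "M = attach_labels E \<beta>" by simp
      moreover have "\<beta> \<in> ?L"
      proof (rule PiE_I)
        fix v assume v: "v \<in> {..<n}"
        have "b v e < d" if "e \<in> ?Ev v" for e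
        proof -
          have "(v, b v e) \<in> P e" "P e \<in> M" using b P that by auto
          thus ?thesis using perfect_matchings_subset[OF M(1)] by (auto simp: nsets_def half_edges_def)
        qed
        moreover have "inj_on (\<beta> v) (?Ev v)"
        proof (rule inj_onI)
          fix e f assume ef: "e \<in> ?Ev v" "f \<in> ?Ev v" "\<beta> v e = \<beta> v f"
          hence "(v, b v e) \<in> P e" "(v, b v e) \<in> P f" using b[of e v] b[of f v] \<beta>b by auto
          hence "P e = P f" using P[of e] P[of f] ef perfect_matching_unique[OF M(1), of "P e" "P f"] by blast
          hence "fst ` P e = fst ` P f" by (rule arg_cong)
          moreover have "fst ` P e = e" "fst ` P f = f" using P ef by blast+
          ultimately show "e = f" by argo
        qed
        ultimately show "\<beta> v \<in> {f \<in> ?Ev v \<rightarrow>\<^sub>E {..<d}. inj_on f (?Ev v)}"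
          using v by (auto simp: \<beta>_def)
      qed (auto simp: \<beta>_def)
      ultimately show "M \<in> attach_labels E ` ?L" by blast
    qed
  qed
  hence "card {M \<in> simple_matchings n d. underlying_graph M = E} = card ?L"
    by (simp add: bij_betw_same_card)
  also have "\<dots> = (\<Prod>v<n. card {f \<in> ?Ev v \<rightarrow>\<^sub>E {..<d}. inj_on f (?Ev v)})"
    by (subst card_PiE) auto
  also have "\<dots> = (\<Prod>v<n. fact d)"
  proof (rule prod.cong[OF refl])
    fix v assume "v \<in> {..<n}"
    thus "card {f \<in> ?Ev v \<rightarrow>\<^sub>E {..<d}. inj_on f (?Ev v)} = fact d"
      using finE deg[of v] by (subst card_inj_on_subset_funcset) (auto simp: fact_prod_rev)
  qed
  finally show ?thesis by simp
qed

lemma card_simple_matchings_Collect: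
  "card {M \<in> simple_matchings n d. P (underlying_graph M)}
     = fact d ^ n * card {E \<in> regular_graphs n d. P E}"
proof -
  have "{M \<in> simple_matchings n d. P (underlying_graph M)}
      = (\<Union>E\<in>{E \<in> regular_graphs n d. P E}. {M \<in> simple_matchings n d. underlying_graph M = E})"
    using underlying_graph_regular by auto
  also have "card \<dots> = (\<Sum>E\<in>{E \<in> regular_graphs n d. P E}.
                 card {M \<in> simple_matchings n d. underlying_graph M = E})"
    using finite_regular_graphs finite_simple_matchings by (intro card_UN_disjoint) auto
  also have "\<dots> = (\<Sum>E\<in>{E \<in> regular_graphs n d. P E}. fact d ^ n)"
    by (intro sum.cong refl card_simple_matchings_over) auto
  finally show ?thesis by simp
qed

section \<open>A pairing is simple with polynomially small probability\<close>

text \<open>The pairs that are loops or belong to a multiple edge.\<close>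

definition defects :: "('a \<times> 'b) set set \<Rightarrow> ('a \<times> 'b) set set" where
  "defects M = {p \<in> M. \<not> inj_on fst p \<or> (\<exists>q\<in>M. q \<noteq> p \<and> fst ` q = fst ` p)}"

lemma simple_matchings_defects:
  "simple_matchings n d = {M \<in> perfect_matchings (half_edges n d). defects M = {}}"
  unfolding simple_matchings_def defects_def by (auto simp: inj_on_def[of "(`) fst"]; blast)

lemma finite_perfect_matching: "M \<in> perfect_matchings X \<Longrightarrow> finite X \<Longrightarrow> finite M"
  unfolding perfect_matchings_def by (auto intro: finite_elements)

lemma finite_defects: "M \<in> perfect_matchings X \<Longrightarrow> finite X \<Longrightarrow> finite (defects M)"
  by (rule finite_subset[OF _ finite_perfect_matching]) (auto simp: defects_def)

lemma card_pairs_meeting: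
  assumes "M \<in> perfect_matchings X" "finite Y"
  shows "card {p \<in> M. p \<inter> Y \<noteq> {}} \<le> card Y"
proof -
  let ?S = "{p \<in> M. p \<inter> Y \<noteq> {}}"
  define g where "g p = (SOME t. t \<in> p \<inter> Y)" for p
  have g: "g p \<in> p \<inter> Y" if "p \<in> ?S" for p
    unfolding g_def by (rule someI_ex) (use that in auto)
  have "inj_on g ?S"
  proof (rule inj_onI)
    fix p q assume pq: "p \<in> ?S" "q \<in> ?S" "g p = g q"
    thus "p = q" using g[OF pq(1)] g[OF pq(2)] perfect_matching_unique[OF assms(1), of p q "g p"] by auto
  qed
  moreover have "g ` ?S \<subseteq> Y" using g by blast
  ultimately show ?thesis using assms(2) card_inj_on_le by blast
qed

lemma card_perfect_matching:
  assumes "M \<in> perfect_matchings X" "finite X"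
  shows "2 * card M = card X"
proof -
  have p: "\<Union>M = X" "disjoint M" "\<And>e. e \<in> M \<Longrightarrow> card e = 2" using assms(1)
    by (auto simp: perfect_matchings_def partition_on_def)
  have fin: "finite M" using finite_perfect_matching assms by blast
  have "card X = (\<Sum>e\<in>M. card e)"
    unfolding p(1)[symmetric]
    by (rule card_Union_disjoint) (use p in \<open>auto simp: pairwise_def disjoint_def disjnt_def intro: card_ge_0_finite\<close>)
  thus ?thesis using p(3) by simp
qed

text \<open>Only boundedly many pairs are near a given pair: at most \<open>2 * d\<close> pairs meet its two vertices, these cover
at most \<open>4 * d\<close> vertices, and at most \<open>4 * d\<^sup>2\<close> pairs meet those.\<close>

lemma exists_far_pair:
  assumes M: "M \<in> perfect_matchings (half_edges n d)" and ab: "{a, b} \<in> M"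
    and large: "card (defects M) + 4 * d\<^sup>2 < card M"
  obtains q where "q \<in> M" "q \<notin> defects M"
    "\<And>r c t. r \<in> M \<Longrightarrow> c \<in> r \<Longrightarrow> fst c \<in> {fst a, fst b} \<Longrightarrow> t \<in> r \<Longrightarrow> fst t \<notin> fst ` q"
proof -
  define R where "R = {r \<in> M. r \<inter> ({fst a, fst b} \<times> {..<d}) \<noteq> {}}"
  define Z where "Z = fst ` \<Union>R"
  have finM: "finite M" using finite_perfect_matching[OF M finite_half_edges] .
  have card2: "card p = 2" "p \<subseteq> half_edges n d" if "p \<in> M" for p
    using perfect_matchings_subset[OF M] that by (auto simp: nsets_def)
  have "card R \<le> card ({fst a, fst b} \<times> {..<d})"
    unfolding R_def by (rule card_pairs_meeting[OF M]) auto
  also have "\<dots> \<le> 2 * d"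
  proof -
    have "card {fst a, fst b} \<le> 2" by (cases "fst a = fst b") auto
    thus ?thesis by (simp add: card_cartesian_product)
  qed
  finally have R: "card R \<le> 2 * d" .
  have "card (\<Union>R) \<le> (\<Sum>r\<in>R. card r)"
    using finM by (intro card_Union_le_sum_card)
  also have "\<dots> = 2 * card R" using card2 by (simp add: R_def)
  finally have "card (\<Union>R) \<le> 4 * d" using R by simp
  moreover have finUR: "finite (\<Union>R)"
    by (rule finite_subset[OF _ finite_half_edges[of n d]]) (use card2 in \<open>auto simp: R_def\<close>)
  ultimately have Z: "card Z \<le> 4 * d" "finite Z"
    unfolding Z_def using card_image_le order_trans by (blast, blast)
  have "card {p \<in> M. p \<inter> (Z \<times> {..<d}) \<noteq> {}} \<le> card (Z \<times> {..<d})"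
    using Z by (intro card_pairs_meeting[OF M]) auto
  also have "\<dots> \<le> 4 * d\<^sup>2" using Z by (simp add: card_cartesian_product power2_eq_square)
  finally have "card (defects M \<union> {p \<in> M. p \<inter> (Z \<times> {..<d}) \<noteq> {}}) \<le> card (defects M) + 4 * d\<^sup>2"
    using card_Un_le[of "defects M" "{p \<in> M. p \<inter> (Z \<times> {..<d}) \<noteq> {}}"] by linarith
  hence "card (defects M \<union> {p \<in> M. p \<inter> (Z \<times> {..<d}) \<noteq> {}}) < card M" using large by linarith
  moreover have "finite (defects M \<union> {p \<in> M. p \<inter> (Z \<times> {..<d}) \<noteq> {}})"
    using finM by (auto simp: defects_def)
  ultimately have "\<not> M \<subseteq> defects M \<union> {p \<in> M. p \<inter> (Z \<times> {..<d}) \<noteq> {}}"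
    using card_mono[of "defects M \<union> {p \<in> M. p \<inter> (Z \<times> {..<d}) \<noteq> {}}" M] by linarith
  then obtain q where q: "q \<in> M" "q \<notin> defects M" "q \<inter> (Z \<times> {..<d}) = {}" by auto
  show ?thesis
  proof (rule that[OF q(1,2)])
    fix r c t assume r: "r \<in> M" "c \<in> r" "fst c \<in> {fst a, fst b}" "t \<in> r"
    have "c \<in> half_edges n d" using card2[OF r(1)] r by auto
    hence "c \<in> {fst a, fst b} \<times> {..<d}" using r(3) by (cases c) (auto simp: half_edges_def)
    hence "r \<in> R" using r by (auto simp: R_def)
    hence tZ: "fst t \<in> Z" using r by (auto simp: Z_def)
    show "fst t \<notin> fst ` q"
    proof
      assume "fst t \<in> fst ` q"
      then obtain s where s: "s \<in> q" "fst s = fst t" by auto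
      have "s \<in> half_edges n d" using card2[OF q(1)] s by auto
      hence "s \<in> Z \<times> {..<d}" using s tZ by (cases s) (auto simp: half_edges_def)
      thus False using s q(3) by auto
    qed
  qed
qed

lemma perfect_matching_switch:
  assumes M: "M \<in> perfect_matchings X" and "{a, b} \<in> M" "{a', b'} \<in> M" "{a, b} \<noteq> {a', b'}"
  shows "insert {a, a'} (insert {b, b'} (M - {{a, b}, {a', b'}})) \<in> perfect_matchings X"
    and "distinct [a, b, a', b']" and "{a, b, a', b'} \<subseteq> X"
proof -
  have ns: "{a, b} \<in> nsets X 2" "{a', b'} \<in> nsets X 2"
    using perfect_matchings_subset[OF M] assms(2,3) by blast+
  have ne: "a \<noteq> b" "a' \<noteq> b'" using ns by simp_all
  have "{a, b} \<inter> {a', b'} = {}" using perfect_matching_unique[OF M assms(2,3)] assms(4) by blast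
  thus dist: "distinct [a, b, a', b']" using ne by auto
  show sub: "{a, b, a', b'} \<subseteq> X" using ns by simp
  obtain N1 where N1: "M = insert {a, b} N1" "N1 \<in> perfect_matchings (X - {a, b})"
    using perfect_matchings_insert[of a X b] M assms(2) dist sub by auto
  have "{a', b'} \<in> N1" using assms N1 by auto
  then obtain N where N: "N1 = insert {a', b'} N" "N \<in> perfect_matchings (X - {a, b} - {a', b'})"
    using perfect_matchings_insert[of a' "X - {a, b}" b'] N1(2) dist sub by auto
  have "{a, b} \<notin> N1" "{a', b'} \<notin> N"
    by (rule insert_notin_perfect_matching[OF N1(2)], rule insert_notin_perfect_matching[OF N(2)])
  hence MN: "M - {{a, b}, {a', b'}} = N" unfolding N1(1) N(1) using assms(4) by auto
  have "X - {a, b} - {a', b'} = X - {a, a'} - {b, b'}" by auto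
  hence "insert {b, b'} N \<in> perfect_matchings (X - {a, a'})"
    using perfect_matchings_insert[of b "X - {a, a'}" b'] N(2) dist sub by auto
  hence "insert {a, a'} (insert {b, b'} N) \<in> perfect_matchings X"
    using perfect_matchings_insert[of a X a'] dist sub by auto
  thus "insert {a, a'} (insert {b, b'} (M - {{a, b}, {a', b'}})) \<in> perfect_matchings X"
    unfolding MN .
qed

text \<open>Replace a defect \<open>{a, b}\<close> and a far, defect-free pair \<open>{a', b'}\<close> by \<open>{a, a'}\<close> and \<open>{b, b'}\<close>. The new pairs are
neither loops nor parallel to anything, because \<open>a'\<close> and \<open>b'\<close> lie at vertices that are not adjacent to
those of \<open>a\<close> and \<open>b\<close>. So no new defect appears and the old one is gone. The last two conclusions say
that the original matching is recovered from the new one by specifying four pairs, which bounds the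
fibres of the switching map.\<close>

lemma switching_reduces_defects:
  assumes M: "M \<in> perfect_matchings (half_edges n d)" and "defects M \<noteq> {}"
    and large: "card (defects M) + 4 * d\<^sup>2 < card M"
  obtains M' p q p' q' where "M' \<in> perfect_matchings (half_edges n d)" "card (defects M') < card (defects M)"
    "M = (M' - {p', q'}) \<union> {p, q}" "{p, q, p', q'} \<subseteq> nsets (half_edges n d) 2"
proof -
  let ?X = "half_edges n d"
  have finM: "finite M" using finite_perfect_matching[OF M finite_half_edges] .
  obtain p where p: "p \<in> defects M" using assms(2) by auto
  hence pM: "p \<in> M" by (auto simp: defects_def)
  have Msub: "M \<subseteq> nsets ?X 2" using perfect_matchings_subset[OF M] .
  obtain a b where ab: "p = {a, b}" "a \<noteq> b" using subsetD[OF Msub pM] unfolding nsets_2_eq by blast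
  obtain q where q: "q \<in> M" "q \<notin> defects M"
    and far: "\<And>r c t. r \<in> M \<Longrightarrow> c \<in> r \<Longrightarrow> fst c \<in> {fst a, fst b} \<Longrightarrow> t \<in> r \<Longrightarrow> fst t \<notin> fst ` q"
    using exists_far_pair[OF M pM[unfolded ab] large] by metis
  obtain a' b' where ab': "q = {a', b'}" "a' \<noteq> b'" using subsetD[OF Msub q(1)] unfolding nsets_2_eq by blast
  have pq: "{a, b} \<noteq> {a', b'}" using p q ab ab' by auto
  note sw = perfect_matching_switch[OF M pM[unfolded ab] q(1)[unfolded ab'] pq]
  define N where "N = M - {p, q}"
  define M' where "M' = insert {a, a'} (insert {b, b'} N)"
  have M': "M' \<in> perfect_matchings ?X" using sw(1) unfolding M'_def N_def ab ab' .
  have notin: "{a, a'} \<notin> M" "{b, b'} \<notin> M"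
    using perfect_matching_unique[OF M _ pM, of "{a, a'}" a] perfect_matching_unique[OF M _ pM, of "{b, b'}" b]
      sw(2) ab by (auto simp: doubleton_eq_iff)
  have fa: "fst a \<notin> fst ` q" "fst b \<notin> fst ` q"
    using far[OF pM, of a a] far[OF pM, of b b] ab by auto
  have qinj: "fst a' \<noteq> fst b'" using q ab' by (auto simp: defects_def)
  have new1: "inj_on fst {a, a'}" "inj_on fst {b, b'}" using fa ab' by auto
  have new2: "fst ` {a, a'} \<noteq> fst ` {b, b'}" using fa ab' qinj by (auto simp: doubleton_eq_iff)
  have new3: "fst ` r \<noteq> fst ` {a, a'}" "fst ` r \<noteq> fst ` {b, b'}" if r: "r \<in> M" for r
  proof -
    show "fst ` r \<noteq> fst ` {a, a'}"
    proof
      assume eq: "fst ` r = fst ` {a, a'}"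
      have "fst a \<in> fst ` r" "fst a' \<in> fst ` r" unfolding eq by auto
      then obtain c t where "c \<in> r" "fst c = fst a" "t \<in> r" "fst t = fst a'" by (metis imageE)
      thus False using far[OF r, of c t] ab' by auto
    qed
    show "fst ` r \<noteq> fst ` {b, b'}"
    proof
      assume eq: "fst ` r = fst ` {b, b'}"
      have "fst b \<in> fst ` r" "fst b' \<in> fst ` r" unfolding eq by auto
      then obtain c t where "c \<in> r" "fst c = fst b" "t \<in> r" "fst t = fst b'" by (metis imageE)
      thus False using far[OF r, of c t] ab' by auto
    qed
  qed
  have "defects M' \<subseteq> defects M - {p}"
  proof
    fix r assume r: "r \<in> defects M'"
    hence rM': "r \<in> M'" by (auto simp: defects_def)
    have bad: "\<not> inj_on fst r \<or> (\<exists>s\<in>M'. s \<noteq> r \<and> fst ` s = fst ` r)" using r by (auto simp: defects_def)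
    have r1: "r \<noteq> {a, a'}"
    proof
      assume req: "r = {a, a'}"
      then obtain s where s: "s \<in> M'" "s \<noteq> {a, a'}" "fst ` s = fst ` {a, a'}" using bad new1 by auto
      hence "s = {b, b'} \<or> s \<in> M" by (auto simp: M'_def N_def)
      thus False using s new2 new3 by metis
    qed
    have r2: "r \<noteq> {b, b'}"
    proof
      assume req: "r = {b, b'}"
      then obtain s where s: "s \<in> M'" "s \<noteq> {b, b'}" "fst ` s = fst ` {b, b'}" using bad new1 by auto
      hence "s = {a, a'} \<or> s \<in> M" by (auto simp: M'_def N_def)
      thus False using s new2 new3 by metis
    qed
    have rN: "r \<in> N" using rM' r1 r2 by (auto simp: M'_def)
    hence rM: "r \<in> M" "r \<noteq> p" by (auto simp: N_def)
    have "\<not> inj_on fst r \<or> (\<exists>s\<in>M. s \<noteq> r \<and> fst ` s = fst ` r)"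
    proof (cases "inj_on fst r")
      case True
      then obtain s where s: "s \<in> M'" "s \<noteq> r" "fst ` s = fst ` r" using bad by auto
      have "s \<noteq> {a, a'}" "s \<noteq> {b, b'}" using s(3) new3[OF rM(1)] by metis+
      hence "s \<in> M" using s(1) by (auto simp: M'_def N_def)
      thus ?thesis using s by blast
    qed auto
    thus "r \<in> defects M - {p}" using rM by (auto simp: defects_def)
  qed
  hence "card (defects M') \<le> card (defects M - {p})"
    using finM by (intro card_mono) (auto simp: defects_def)
  also have "\<dots> < card (defects M)"
    using p finM by (intro card_Diff1_less) (auto simp: defects_def)
  finally have less: "card (defects M') < card (defects M)" .
  have "M = (M' - {{a, a'}, {b, b'}}) \<union> {p, q}"
    using notin pM q(1) by (auto simp: M'_def N_def)
  moreover have "{p, q, {a, a'}, {b, b'}} \<subseteq> nsets ?X 2"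
    using Msub pM q(1) sw(2,3) by auto
  ultimately show ?thesis using that[OF M' less] by blast
qed

lemma card_nsets_2_le: "finite X \<Longrightarrow> card (nsets X 2) \<le> (card X)\<^sup>2"
proof -
  assume X: "finite X"
  have "nsets X 2 \<subseteq> (\<lambda>(a, b). {a, b}) ` (X \<times> X)"
  proof
    fix e assume "e \<in> nsets X 2"
    then obtain a b where "e = {a, b}" "a \<in> X" "b \<in> X" by (auto simp: nsets_2_eq)
    thus "e \<in> (\<lambda>(a, b). {a, b}) ` (X \<times> X)" by (intro image_eqI[of _ _ "(a, b)"]) auto
  qed
  hence "card (nsets X 2) \<le> card (X \<times> X)" using X by (intro surj_card_le) auto
  thus ?thesis by (simp add: card_cartesian_product power2_eq_square)
qed

lemma card_few_defects:
  assumes "2 * (c + 4 * d\<^sup>2) < d * n"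
  shows "card {M \<in> perfect_matchings (half_edges n d). card (defects M) \<le> c}
           \<le> (1 + (d * n) ^ 8) ^ c * card (simple_matchings n d)"
  using assms
proof (induction c)
  case 0
  have "{M \<in> perfect_matchings (half_edges n d). card (defects M) \<le> 0} = simple_matchings n d"
    unfolding simple_matchings_defects
  proof (rule Collect_cong, rule conj_cong[OF refl])
    fix M assume "M \<in> perfect_matchings (half_edges n d)"
    hence "finite (defects M)" by (rule finite_defects[OF _ finite_half_edges])
    thus "card (defects M) \<le> 0 \<longleftrightarrow> defects M = {}" by simp
  qed
  thus ?case by simp
next
  case (Suc c)
  let ?PM = "perfect_matchings (half_edges n d)" and ?N = "nsets (half_edges n d) 2"
  let ?S = "\<lambda>c. {M \<in> ?PM. card (defects M) \<le> c}"
  \<comment> \<open>The matching before a switch, recovered from the one after it and the four pairs involved.\<close>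
  let ?g = "\<lambda>(p, q, p', q'). \<lambda>M'. (M' - {p', q'}) \<union> {p, q}"
  have finN: "finite ?N" by (simp add: finite_imp_finite_nsets finite_half_edges)
  have finS: "finite (?S c)" for c by (intro finite_perfect_matchings_Collect finite_half_edges)
  have sub: "?S (Suc c) \<subseteq> ?S c \<union> (\<Union>t\<in>?N \<times> ?N \<times> ?N \<times> ?N. ?g t ` ?S c)"
  proof
    fix M assume M: "M \<in> ?S (Suc c)"
    show "M \<in> ?S c \<union> (\<Union>t\<in>?N \<times> ?N \<times> ?N \<times> ?N. ?g t ` ?S c)"
    proof (cases "card (defects M) \<le> c")
      case False
      hence c: "card (defects M) = Suc c" using M by auto
      hence ne: "defects M \<noteq> {}" by auto
      have "2 * card M = d * n"
        using card_perfect_matching[of M "half_edges n d"] M finite_half_edges card_half_edges by auto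
      hence "2 * (Suc c + 4 * d\<^sup>2) < 2 * card M" using Suc.prems by simp
      hence large: "card (defects M) + 4 * d\<^sup>2 < card M" unfolding c by simp
      have "M \<in> ?PM" using M by simp
      then obtain M' p q p' q' where sw: "M' \<in> ?PM" "card (defects M') < card (defects M)"
          "M = (M' - {p', q'}) \<union> {p, q}" "{p, q, p', q'} \<subseteq> ?N"
        using ne large by (rule switching_reduces_defects)
      have "M = ?g (p, q, p', q') M'" using sw(3) by simp
      moreover have "M' \<in> ?S c" using sw(1,2) c by simp
      ultimately have "M \<in> ?g (p, q, p', q') ` ?S c" by (rule image_eqI)
      moreover have "(p, q, p', q') \<in> ?N \<times> ?N \<times> ?N \<times> ?N" using sw(4) by simp
      ultimately show ?thesis by (intro UnI2 UN_I)
    qed (use M in auto)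
  qed
  have "card (?S (Suc c)) \<le> card (?S c \<union> (\<Union>t\<in>?N \<times> ?N \<times> ?N \<times> ?N. ?g t ` ?S c))"
    using finN finS by (intro card_mono[OF _ sub]) auto
  also have "\<dots> \<le> card (?S c) + card (\<Union>t\<in>?N \<times> ?N \<times> ?N \<times> ?N. ?g t ` ?S c)" by (rule card_Un_le)
  also have "card (\<Union>t\<in>?N \<times> ?N \<times> ?N \<times> ?N. ?g t ` ?S c)
      \<le> (\<Sum>t\<in>?N \<times> ?N \<times> ?N \<times> ?N. card (?g t ` ?S c))"
    using finN by (intro card_UN_le) auto
  also have "\<dots> \<le> (\<Sum>t\<in>?N \<times> ?N \<times> ?N \<times> ?N. card (?S c))"
    using finS by (intro sum_mono card_image_le)
  also have "\<dots> = card ?N ^ 4 * card (?S c)" by (simp add: card_cartesian_product power4_eq_xxxx)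
  also have "\<dots> \<le> ((d * n)\<^sup>2) ^ 4 * card (?S c)"
    using card_nsets_2_le[OF finite_half_edges, of n d] card_half_edges[of n d]
    by (intro mult_right_mono power_mono) auto
  finally have "card (?S (Suc c)) \<le> (1 + (d * n) ^ 8) * card (?S c)"
    by (simp add: algebra_simps flip: power_mult)
  also have "\<dots> \<le> (1 + (d * n) ^ 8) * ((1 + (d * n) ^ 8) ^ c * card (simple_matchings n d))"
    using Suc by (intro mult_left_mono) auto
  finally show ?case by (simp add: mult_ac)
qed

text \<open>The expected number of defects of a random pairing is at most \<open>6 * d\<^sup>2\<close>. Each loop has probability
about \<open>1 / (d * n)\<close> and there are at most \<open>d * (d * n)\<close> of them; each pair of parallel pairs has
probability about \<open>1 / (d * n)\<^sup>2\<close>, and there are at most \<open>(d * n)\<^sup>2 * d\<^sup>2\<close> of these.\<close>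

lemma sum_defects_le:
  assumes "d \<ge> 1" "d * n \<ge> 6"
  shows "(\<Sum>M\<in>perfect_matchings (half_edges n d). card (defects M)) \<le> 6 * d\<^sup>2 * matching_number (d * n)"
proof -
  let ?X = "half_edges n d" and ?PM = "perfect_matchings (half_edges n d)"
  define m where "m = d * n"
  have finX: "finite ?X" and cX: "card ?X = m" by (simp_all add: finite_half_edges card_half_edges m_def)
  have finPM: "finite ?PM" by (simp add: finite_perfect_matchings finX)
  \<comment> \<open>\<open>L\<close> indexes the possible loops and \<open>Q\<close> the possible ordered pairs of parallel pairs, each by the
    half-edges involved; their sizes follow because the second half-edge at a vertex is determined by
    its label.\<close>
  define L where "L = {(a, b) \<in> ?X \<times> ?X. a \<noteq> b \<and> fst a = fst b}"
  define Q where "Q = {((a, b), (a', b')) \<in> (?X \<times> ?X) \<times> (?X \<times> ?X). distinct [a, b, a', b']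
      \<and> fst a = fst a' \<and> fst b = fst b'}"
  have finL: "finite L"
    by (rule finite_subset[of _ "?X \<times> ?X"]) (auto simp: L_def finX)
  have finQ: "finite Q"
    by (rule finite_subset[of _ "(?X \<times> ?X) \<times> (?X \<times> ?X)"]) (auto simp: Q_def finX)
  have "L \<subseteq> (\<lambda>(a, j). (a, (fst a, j))) ` (?X \<times> {..<d})"
    by (auto simp: L_def half_edges_def image_iff)
  hence "card L \<le> card (?X \<times> {..<d})" using finX by (intro surj_card_le) auto
  hence cL: "card L \<le> m * d" using cX by (simp add: card_cartesian_product)
  have "Q \<subseteq> (\<lambda>((a, b), (i, j)). ((a, b), ((fst a, i), (fst b, j)))) ` ((?X \<times> ?X) \<times> ({..<d} \<times> {..<d}))"
    by (auto simp: Q_def half_edges_def image_iff)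
  hence "card Q \<le> card ((?X \<times> ?X) \<times> ({..<d} \<times> {..<d}))" using finX
    by (intro surj_card_le) auto
  hence cQ: "card Q \<le> m\<^sup>2 * d\<^sup>2" using cX by (simp add: card_cartesian_product power2_eq_square)
  have defects_le: "card (defects M) \<le> card {t \<in> L. {fst t, snd t} \<in> M}
      + card {t \<in> Q. {fst (fst t), snd (fst t)} \<in> M \<and> {fst (snd t), snd (snd t)} \<in> M}"
    if M: "M \<in> ?PM" for M
  proof -
    have Msub: "M \<subseteq> nsets ?X 2" using perfect_matchings_subset[OF M] .
    let ?L = "{t \<in> L. {fst t, snd t} \<in> M}"
      and ?Q = "{t \<in> Q. {fst (fst t), snd (fst t)} \<in> M \<and> {fst (snd t), snd (snd t)} \<in> M}"
    have "defects M \<subseteq> (\<lambda>t. {fst t, snd t}) ` ?L \<union> (\<lambda>t. {fst (fst t), snd (fst t)}) ` ?Q"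
    proof
      fix p assume p: "p \<in> defects M"
      hence pM: "p \<in> M" by (auto simp: defects_def)
      obtain a b where ab: "p = {a, b}" "a \<noteq> b" "a \<in> ?X" "b \<in> ?X"
        using subsetD[OF Msub pM] unfolding nsets_2_eq by blast
      show "p \<in> (\<lambda>t. {fst t, snd t}) ` ?L \<union> (\<lambda>t. {fst (fst t), snd (fst t)}) ` ?Q"
      proof (cases "fst a = fst b")
        case True
        hence "(a, b) \<in> ?L" using ab pM by (auto simp: L_def)
        moreover have "p = {fst (a, b), snd (a, b)}" using ab by simp
        ultimately show ?thesis by blast
      next
        case False
        hence "inj_on fst p" using ab by auto
        then obtain q where q: "q \<in> M" "q \<noteq> p" "fst ` q = {fst a, fst b}" using p ab by (auto simp: defects_def)
        obtain s t where st: "q = {s, t}" "s \<noteq> t" "s \<in> ?X" "t \<in> ?X"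
          using subsetD[OF Msub q(1)] unfolding nsets_2_eq by blast
        have "{fst s, fst t} = {fst a, fst b}" using q(3) st(1) by auto
        hence "fst s = fst a \<and> fst t = fst b \<or> fst t = fst a \<and> fst s = fst b"
          by (auto simp: doubleton_eq_iff)
        then obtain a' b' where ab': "q = {a', b'}" "a' \<noteq> b'" "a' \<in> ?X" "b' \<in> ?X" "fst a' = fst a" "fst b' = fst b"
        proof (rule disjE)
          assume "fst s = fst a \<and> fst t = fst b"
          thus ?thesis using st by (intro that[of s t]) auto
        next
          assume "fst t = fst a \<and> fst s = fst b"
          thus ?thesis using st by (intro that[of t s]) auto
        qed
        have "distinct [a, b, a', b']"
          using perfect_matching_switch(2)[OF M pM[unfolded ab] q(1)[unfolded ab']] q(2) ab ab' by auto
        hence "((a, b), (a', b')) \<in> ?Q" using ab ab' pM q(1) by (auto simp: Q_def)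
        moreover have "p = {fst (fst ((a, b), (a', b'))), snd (fst ((a, b), (a', b')))}" using ab by simp
        ultimately show ?thesis by blast
      qed
    qed
    hence "card (defects M) \<le> card ((\<lambda>t. {fst t, snd t}) ` ?L \<union> (\<lambda>t. {fst (fst t), snd (fst t)}) ` ?Q)"
      using finL finQ by (intro card_mono) auto
    also have "\<dots> \<le> card ((\<lambda>t. {fst t, snd t}) ` ?L) + card ((\<lambda>t. {fst (fst t), snd (fst t)}) ` ?Q)"
      by (rule card_Un_le)
    also have "\<dots> \<le> card ?L + card ?Q"
      using finL finQ by (intro add_mono card_image_le) auto
    finally show ?thesis .
  qed
  have oneL: "card {M \<in> ?PM. {fst t, snd t} \<in> M} = matching_number (m - 2)" if "t \<in> L" for t
  proof -
    have t: "fst t \<in> ?X" "snd t \<in> ?X" "fst t \<noteq> snd t" using that by (auto simp: L_def)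
    have "card {M \<in> ?PM. {fst t, snd t} \<in> M} = card (perfect_matchings (?X - {fst t, snd t}))"
      by (rule card_perfect_matchings_insert[OF t])
    also have "\<dots> = matching_number (card (?X - {fst t, snd t}))"
      using finX by (intro card_perfect_matchings) auto
    also have "card (?X - {fst t, snd t}) = m - 2" using finX t cX by (subst card_Diff_subset) auto
    finally show ?thesis .
  qed
  have oneQ: "card {M \<in> ?PM. {fst (fst t), snd (fst t)} \<in> M \<and> {fst (snd t), snd (snd t)} \<in> M}
      \<le> matching_number (m - 4)" if "t \<in> Q" for t
  proof -
    obtain a b a' b' where t1: "t = ((a, b), (a', b'))" by (metis surj_pair)
    hence "distinct [a, b, a', b']" "{a, b, a', b'} \<subseteq> ?X" using that by (auto simp: Q_def)
    note t = t1 this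
    have "{M \<in> ?PM. {a, b} \<in> M \<and> {a', b'} \<in> M}
        \<subseteq> insert {a, b} ` {M \<in> perfect_matchings (?X - {a, b}). {a', b'} \<in> M}"
    proof
      fix M assume M: "M \<in> {M \<in> ?PM. {a, b} \<in> M \<and> {a', b'} \<in> M}"
      hence "M \<in> insert {a, b} ` perfect_matchings (?X - {a, b})"
        using perfect_matchings_insert[of a ?X b] t by auto
      then obtain N where N: "M = insert {a, b} N" "N \<in> perfect_matchings (?X - {a, b})" by auto
      moreover have "{a', b'} \<in> N" using M N t(2) by (auto simp: doubleton_eq_iff)
      ultimately show "M \<in> insert {a, b} ` {M \<in> perfect_matchings (?X - {a, b}). {a', b'} \<in> M}" by blast
    qed
    hence "card {M \<in> ?PM. {a, b} \<in> M \<and> {a', b'} \<in> M}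
        \<le> card {M \<in> perfect_matchings (?X - {a, b}). {a', b'} \<in> M}"
      using finX by (intro surj_card_le) (auto intro: finite_perfect_matchings_Collect)
    also have "\<dots> = card (perfect_matchings (?X - {a, b} - {a', b'}))"
      using t by (intro card_perfect_matchings_insert) auto
    also have "\<dots> = matching_number (card (?X - {a, b} - {a', b'}))"
      using finX by (intro card_perfect_matchings) auto
    also have "?X - {a, b} - {a', b'} = ?X - {a, b, a', b'}" by auto
    also have "card \<dots> = m - 4" using finX t cX by (subst card_Diff_subset) auto
    finally show ?thesis using t(1) by simp
  qed
  have swap: "(\<Sum>M\<in>?PM. card {t \<in> T. P t M}) = (\<Sum>t\<in>T. card {M \<in> ?PM. P t M})"
    if "finite T" for T :: "'c set" and P
  proof -
    have "(\<Sum>M\<in>?PM. card {t \<in> T. P t M}) = (\<Sum>M\<in>?PM. \<Sum>t\<in>T. if P t M then 1 else 0)"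
      using that by (simp add: sum.If_cases Int_def)
    also have "\<dots> = (\<Sum>t\<in>T. \<Sum>M\<in>?PM. if P t M then 1 else 0)" by (rule sum.swap)
    also have "\<dots> = (\<Sum>t\<in>T. card {M \<in> ?PM. P t M})"
      using finPM by (simp add: sum.If_cases Int_def)
    finally show ?thesis .
  qed
  have "(\<Sum>M\<in>?PM. card (defects M)) \<le> (\<Sum>M\<in>?PM. card {t \<in> L. {fst t, snd t} \<in> M}
      + card {t \<in> Q. {fst (fst t), snd (fst t)} \<in> M \<and> {fst (snd t), snd (snd t)} \<in> M})"
    by (rule sum_mono[OF defects_le])
  also have "\<dots> = (\<Sum>t\<in>L. card {M \<in> ?PM. {fst t, snd t} \<in> M})
      + (\<Sum>t\<in>Q. card {M \<in> ?PM. {fst (fst t), snd (fst t)} \<in> M \<and> {fst (snd t), snd (snd t)} \<in> M})"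
    unfolding sum.distrib by (simp only: swap[OF finL] swap[OF finQ])
  also have "\<dots> \<le> (\<Sum>t\<in>L. matching_number (m - 2)) + (\<Sum>t\<in>Q. matching_number (m - 4))"
    by (intro add_mono sum_mono) (auto simp: oneL oneQ)
  also have "\<dots> = card L * matching_number (m - 2) + card Q * matching_number (m - 4)" by simp
  also have "\<dots> \<le> m * d * matching_number (m - 2) + m\<^sup>2 * d\<^sup>2 * matching_number (m - 4)"
    by (intro add_mono mult_right_mono cL cQ) auto
  also have "\<dots> \<le> 6 * d\<^sup>2 * matching_number m"
  proof -
    \<comment> \<open>Writing \<open>m = k + 6\<close> avoids truncated subtraction in the recursion for the matching numbers.\<close>
    obtain k where k: "m = k + 6" using assms(2) m_def by (metis le_add_diff_inverse2)
    have 1: "matching_number m = (k + 5) * matching_number (m - 2)"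
      and 2: "matching_number (m - 2) = (k + 3) * matching_number (m - 4)"
      by (simp_all add: k eval_nat_numeral)
    have "m * d * matching_number (m - 2) \<le> 2 * d\<^sup>2 * ((k + 5) * matching_number (m - 2))"
    proof -
      have "m * d \<le> (2 * (k + 5)) * d\<^sup>2"
        unfolding k using assms(1) by (intro mult_mono) (auto simp: power2_eq_square)
      hence "m * d * matching_number (m - 2) \<le> (2 * (k + 5)) * d\<^sup>2 * matching_number (m - 2)"
        by (rule mult_right_mono) simp
      thus ?thesis by (simp only: mult_ac)
    qed
    moreover have "m\<^sup>2 * d\<^sup>2 * matching_number (m - 4) \<le> 4 * d\<^sup>2 * ((k + 5) * ((k + 3) * matching_number (m - 4)))"
    proof -
      have "m\<^sup>2 \<le> 4 * ((k + 5) * (k + 3))" unfolding k by (simp add: power2_eq_square algebra_simps)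
      hence "m\<^sup>2 * (d\<^sup>2 * matching_number (m - 4)) \<le> 4 * ((k + 5) * (k + 3)) * (d\<^sup>2 * matching_number (m - 4))"
        by (rule mult_right_mono) simp
      thus ?thesis by (simp only: mult_ac)
    qed
    ultimately show ?thesis unfolding 1 2 by (simp add: algebra_simps)
  qed
  finally show ?thesis unfolding m_def .
qed

text \<open>By Markov's inequality at least half of all pairings have at most \<open>12 * d\<^sup>2\<close> defects, and each
switching step costs only a polynomial factor. A polynomial loss is harmless here, since the first moment is exponentially
small.\<close>

lemma matching_number_le_simple:
  assumes "d \<ge> 1" "n > 32 * d"
  shows "matching_number (d * n) \<le> 2 * (1 + (d * n) ^ 8) ^ (12 * d\<^sup>2) * card (simple_matchings n d)"
proof -
  let ?PM = "perfect_matchings (half_edges n d)" and ?c = "12 * d\<^sup>2"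
  let ?S = "{M \<in> ?PM. card (defects M) \<le> ?c}"
  have finPM: "finite ?PM" by (simp add: finite_perfect_matchings finite_half_edges)
  have cPM: "card ?PM = matching_number (d * n)"
    by (simp add: card_perfect_matchings finite_half_edges card_half_edges)
  have "d * (32 * d) < d * n" using assms by simp
  hence big: "2 * (?c + 4 * d\<^sup>2) < d * n" by (simp add: power2_eq_square)
  have dn: "d * n \<ge> 6"
  proof -
    have "1 * 6 \<le> d * n" using assms by (intro mult_mono) auto
    thus ?thesis by simp
  qed
  have "?c * card (?PM - ?S) = (\<Sum>M\<in>?PM - ?S. ?c)" by simp
  also have "\<dots> \<le> (\<Sum>M\<in>?PM - ?S. card (defects M))" by (intro sum_mono) auto
  also have "\<dots> \<le> (\<Sum>M\<in>?PM. card (defects M))" using finPM by (intro sum_mono2) auto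
  also have "\<dots> \<le> 6 * d\<^sup>2 * matching_number (d * n)" by (rule sum_defects_le[OF assms(1) dn])
  finally have "6 * d\<^sup>2 * (2 * card (?PM - ?S)) \<le> 6 * d\<^sup>2 * matching_number (d * n)" by simp
  hence "2 * card (?PM - ?S) \<le> card ?PM" using assms(1) cPM by simp
  moreover have "card (?PM - ?S) = card ?PM - card ?S" using finPM by (intro card_Diff_subset) auto
  ultimately have "card ?PM \<le> 2 * card ?S" by linarith
  also have "card ?S \<le> (1 + (d * n) ^ 8) ^ ?c * card (simple_matchings n d)"
    by (rule card_few_defects[OF big])
  finally show ?thesis using cPM by simp
qed

section \<open>The exponent and its zero\<close>

text \<open>The entropy function, continuous on the whole line because \<open>ln (- t) = ln t\<close> and \<open>t * ln t\<close> tends to \<open>0 = 0 * ln 0\<close>. Writing the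
exponents with it makes their continuity at the ends of the range of \<open>y\<close> automatic.\<close>

definition xlnx :: "real \<Rightarrow> real" where
  "xlnx t = t * ln t"

lemma isCont_xlnx: "isCont xlnx t"
proof (cases "t = 0")
  case False
  thus ?thesis unfolding xlnx_def by (intro continuous_intros) auto
next
  case True
  have "((\<lambda>t::real. t * ln t) \<longlongrightarrow> 0) (at_right 0)" by real_asymp
  moreover have "((\<lambda>t::real. t * ln t) \<longlongrightarrow> 0) (at_left 0)"
    unfolding filterlim_at_left_to_right[of _ _ 0]
    by (simp add: ln_minus) real_asymp
  ultimately have "((\<lambda>t::real. t * ln t) \<longlongrightarrow> 0) (at 0)" by (intro filterlim_split_at)
  thus ?thesis unfolding True isCont_def xlnx_def by simp
qed

lemma continuous_on_xlnx [continuous_intros]: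
  "continuous_on S f \<Longrightarrow> continuous_on S (\<lambda>t. xlnx (f t))"
  using continuous_on_compose2[of UNIV xlnx S f] isCont_xlnx
  by (auto intro: continuous_at_imp_continuous_on)

lemma xlnx_derivative:
  assumes "(f has_real_derivative f') (at t)" "0 < f t"
  shows "((\<lambda>t. xlnx (f t)) has_real_derivative (ln (f t) + 1) * f') (at t)"
  unfolding xlnx_def using assms
  by (auto intro!: derivative_eq_intros simp: algebra_simps)

lemma xlnx_mult: "0 \<le> a \<Longrightarrow> 0 \<le> b \<Longrightarrow> xlnx (a * b) = b * xlnx a + a * xlnx b"
  by (cases "a = 0"; cases "b = 0") (auto simp: xlnx_def ln_mult algebra_simps)

lemma f_exp_xlnx:
  "f_exp d u s y x = xlnx (real d * u) + xlnx (real d - real d * u - y) / 2 + s * ln ((x + 1) ^ d - 1)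
     - y * ln x - xlnx u - xlnx s - xlnx (1 - u - s) - xlnx (real d * u - y) / 2 - xlnx (real d) / 2"
  unfolding f_exp_def xlnx_def by simp

context
  fixes d :: nat and u :: real
  assumes d: "d \<ge> 3" and u: "0 < u" "u \<le> 1/2"
begin

lemma density_le_complement: "real d * u \<le> real d - real d * u"
proof -
  have "real d * u \<le> real d * (1/2)" using u by (intro mult_left_mono) auto
  thus ?thesis by linarith
qed

lemma free_half_edges_pos:
  "y < real d * u \<Longrightarrow> 0 < real d * u - y" "y < real d * u \<Longrightarrow> 0 < real d - real d * u - y"
  using density_le_complement by linarith+

lemma crossing_bound_less: "real d * u * (1 - u) < real d * u"
  using d u by (simp add: algebra_simps)

lemma x_hat_pos: "y < real d * u \<Longrightarrow> 0 < x_hat d u y"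
  using free_half_edges_pos[of y] by (simp add: x_hat_def)

text \<open>With \<open>w = 1 / (1 + x)\<close> the quotient in \<open>s_hat\<close> is \<open>(1 - w ^ d) / (1 - w)\<close>, a geometric sum. In this form the
monotonicity of \<open>s_hat\<close> is visible, since \<open>x_hat\<close> does not increase with \<open>y\<close> when \<open>u \<le> 1/2\<close>.\<close>

lemma s_hat_eq:
  assumes "y < real d * u"
  shows "s_hat d u y = y / real d * (\<Sum>i<d. (1 / (1 + x_hat d u y)) ^ i)"
proof -
  define x where "x = x_hat d u y"
  define w where "w = 1 / (1 + x)"
  have x: "x > 0" unfolding x_def by (rule x_hat_pos[OF assms])
  have "(x + 1) ^ d - 1 = (x + 1) ^ d * (1 - w ^ d)"
    using x by (simp add: w_def algebra_simps power_divide)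
  also have "1 - w ^ d = (1 - w) * (\<Sum>i<d. w ^ i)" by (rule one_diff_power_eq)
  also have "1 - w = x / (x + 1)" using x by (simp add: w_def field_simps)
  also have "(x + 1) ^ d * (x / (x + 1) * (\<Sum>i<d. w ^ i)) = (x * (x + 1) ^ (d - 1)) * (\<Sum>i<d. w ^ i)"
    using x d by (cases d) (auto simp: field_simps)
  finally have "s_hat d u y = y * ((x * (x + 1) ^ (d - 1)) * (\<Sum>i<d. w ^ i)) / (x * real d * (x + 1) ^ (d - 1))"
    unfolding s_hat_def x_def[symmetric] by simp
  also have "\<dots> = y / real d * (\<Sum>i<d. w ^ i)" using x d by (simp add: field_simps)
  finally show ?thesis by (simp add: w_def x_def)
qed

lemma sum_power_pos: "0 \<le> w \<Longrightarrow> 0 < (\<Sum>i<d. w ^ i)" for w :: real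
  using d by (cases d) (auto simp: sum.lessThan_Suc_shift intro!: add_pos_nonneg sum_nonneg
      simp del: sum.lessThan_Suc)

lemma s_hat_pos: "0 < y \<Longrightarrow> y < real d * u \<Longrightarrow> 0 < s_hat d u y"
  using d x_hat_pos[of y] by (subst s_hat_eq) (auto intro!: divide_pos_pos mult_pos_pos sum_power_pos)

lemma x_hat_derivative:
  assumes "y < real d * u"
  obtains x' where "(x_hat d u has_real_derivative x') (at y)" "x' \<le> 0"
proof -
  let ?a = "real d * u - y" and ?b = "real d - real d * u - y"
  have ab: "0 < ?a" "?a \<le> ?b" "0 < ?b" using assms density_le_complement by linarith+
  have 1: "((\<lambda>y. (real d * u - y) / (real d - real d * u - y)) has_real_derivative (?a - ?b) / ?b\<^sup>2) (at y)"
    using ab by (auto intro!: derivative_eq_intros simp: power2_eq_square field_simps)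
  have "((\<lambda>y. sqrt ((real d * u - y) / (real d - real d * u - y))) has_real_derivative
      (?a - ?b) / ?b\<^sup>2 * (inverse (sqrt (?a / ?b)) / 2)) (at y)"
    using ab DERIV_chain2[OF DERIV_real_sqrt 1] by (simp add: mult.commute)
  moreover have "(?a - ?b) / ?b\<^sup>2 * (inverse (sqrt (?a / ?b)) / 2) \<le> 0"
    using ab by (intro mult_nonpos_nonneg divide_nonpos_nonneg) auto
  ultimately show ?thesis using that unfolding x_hat_def[abs_def] by blast
qed

lemma s_hat_derivative:
  assumes "0 < y" "y < real d * u"
  obtains s' where "(s_hat d u has_real_derivative s') (at y)" "0 < s'"
proof -
  obtain x' where x': "(x_hat d u has_real_derivative x') (at y)" "x' \<le> 0"
    using x_hat_derivative[OF assms(2)] .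
  have xp: "x_hat d u y > 0" using x_hat_pos[OF assms(2)] .
  define w where "w y = 1 / (1 + x_hat d u y)" for y
  define w' where "w' = - x' / (1 + x_hat d u y)\<^sup>2"
  have w: "(w has_real_derivative w') (at y)"
    unfolding w_def[abs_def] w'_def
    by (rule derivative_eq_intros x' refl | use xp in \<open>simp add: power2_eq_square\<close>)+
  have w'0: "0 \<le> w'" and wp: "0 < w y" using x'(2) xp by (auto simp: w'_def w_def intro!: divide_nonpos_pos)
  define T where "T = (\<Sum>i<d. real i * w y ^ (i - 1) * w')"
  define P where "P y = (\<Sum>i<d. w y ^ i)" for y
  have "(P has_real_derivative T) (at y)"
    unfolding T_def P_def[abs_def] by (auto intro!: derivative_eq_intros w simp: mult_ac)
  hence "((\<lambda>y. y / real d * P y) has_real_derivative (1 / real d * P y + y / real d * T)) (at y)"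
    using d by (auto intro!: derivative_eq_intros simp: add_divide_distrib mult.commute)
  hence "((\<lambda>y. y / real d * (\<Sum>i<d. w y ^ i)) has_real_derivative
      (1 / real d * (\<Sum>i<d. w y ^ i) + y / real d * T)) (at y)"
    unfolding P_def .
  moreover have "eventually (\<lambda>t. t \<in> {..<real d * u}) (nhds y)"
    using assms by (intro eventually_nhds_in_open) auto
  hence "eventually (\<lambda>t. s_hat d u t = t / real d * (\<Sum>i<d. w t ^ i)) (nhds y)"
    by eventually_elim (auto simp: s_hat_eq w_def)
  ultimately have "(s_hat d u has_real_derivative
      (1 / real d * (\<Sum>i<d. w y ^ i) + y / real d * T)) (at y)"
    by (subst DERIV_cong_ev[OF refl _ refl]) auto
  moreover have "0 \<le> T" unfolding T_def using wp w'0 by (intro sum_nonneg) auto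
  hence "0 < 1 / real d * (\<Sum>i<d. w y ^ i) + y / real d * T"
    using sum_power_pos[of "w y"] wp assms d by (intro add_pos_nonneg) auto
  ultimately show ?thesis using that by blast
qed

text \<open>The right-hand side is the value of \<open>s\<close> at which the derivative of \<open>f_exp\<close> in \<open>s\<close> vanishes; the two sides
agree at \<open>y = d * u * (1 - u)\<close>, the number of crossing edges per vertex for a typical set. Below that
point \<open>x_hat\<close> is at least its value \<open>u / (1 - u)\<close> there.\<close>

lemma s_hat_less:
  assumes "0 < y" "y < real d * u * (1 - u)"
  shows "s_hat d u y < (1 - u) * (1 - (1 / (1 + x_hat d u y)) ^ d)"
proof -
  have y: "y < real d * u" using assms crossing_bound_less by simp
  let ?a = "real d * u - y" and ?b = "real d - real d * u - y"
  have ab: "0 < ?a" "0 < ?b" using free_half_edges_pos[OF y] by auto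
  define w where "w = 1 / (1 + x_hat d u y)"
  have xp: "x_hat d u y > 0" using x_hat_pos[OF y] .
  have w01: "0 < w" "w < 1" using xp by (auto simp: w_def)
  have "?a * (1 - u)\<^sup>2 - u\<^sup>2 * ?b = (real d * u * (1 - u) - y) * (1 - 2 * u)"
    by (simp add: power2_eq_square algebra_simps)
  also have "\<dots> \<ge> 0" using assms u by simp
  finally have "(u / (1 - u))\<^sup>2 \<le> ?a / ?b" using ab u by (simp add: power_divide field_simps)
  hence "u / (1 - u) \<le> x_hat d u y" unfolding x_hat_def using u by (intro real_le_rsqrt) auto
  hence "u \<le> x_hat d u y * (1 - u)" using u by (simp add: field_simps)
  hence "u \<le> 1 - w" using xp by (simp add: w_def field_simps)
  hence "real d * u * (1 - u) \<le> real d * (1 - w) * (1 - u)"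
    using u by (intro mult_right_mono mult_left_mono) auto
  hence "y / real d < (1 - u) * (1 - w)" using assms d by (simp add: field_simps)
  hence "y / real d * (\<Sum>i<d. w ^ i) < (1 - u) * (1 - w) * (\<Sum>i<d. w ^ i)"
    using sum_power_pos[of w] w01 by (intro mult_strict_right_mono) auto
  thus ?thesis unfolding s_hat_eq[OF y] w_def[symmetric] one_diff_power_eq[of w d] by (simp add: mult_ac)
qed

lemma s_hat_less_complement:
  assumes "0 < y" "y < real d * u * (1 - u)"
  shows "s_hat d u y < 1 - u"
proof -
  have "y < real d * u" using assms crossing_bound_less by simp
  hence "0 < (1 / (1 + x_hat d u y)) ^ d" using x_hat_pos[of y] by simp
  hence "(1 - u) * (1 - (1 / (1 + x_hat d u y)) ^ d) < (1 - u) * 1"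
    using u by (intro mult_strict_left_mono) auto
  thus ?thesis using s_hat_less[OF assms] by simp
qed

text \<open>The solution \<open>z\<close> of \<open>z * ((1 + x) ^ d - 1) = s / (1 - u - s)\<close>, which makes the Chernoff bound tight when
the boundary has \<open>s * n\<close> vertices. Its logarithm is also minus the derivative of \<open>f_exp\<close> in \<open>s\<close>.\<close>

definition z_tilt :: "real \<Rightarrow> real" where
  "z_tilt y = s_hat d u y / (1 - u - s_hat d u y) / ((1 + x_hat d u y) ^ d - 1)"

lemma z_tilt_bounds:
  assumes "0 < y" "y < real d * u * (1 - u)"
  shows "0 < z_tilt y" "z_tilt y < 1"
proof -
  define x where "x = x_hat d u y"
  define s where "s = s_hat d u y"
  have y: "y < real d * u" using assms crossing_bound_less by simp
  have x: "x > 0" using x_hat_pos[OF y] x_def by simp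
  have s: "0 < s" "s < 1 - u" using s_hat_pos[OF assms(1) y] s_hat_less_complement[OF assms] by (auto simp: s_def)
  have g: "(1 + x) ^ d > 1" using x d by (intro one_less_power) auto
  show "0 < z_tilt y" using s g unfolding z_tilt_def s_def[symmetric] x_def[symmetric] by auto
  have "s < (1 - u) * (1 - 1 / (1 + x) ^ d)"
    using s_hat_less[OF assms] by (simp add: s_def x_def power_divide)
  hence "s * (1 + x) ^ d < (1 - u) * ((1 + x) ^ d - 1)"
    using x by (simp add: field_simps)
  hence "s < (1 - u - s) * ((1 + x) ^ d - 1)" by (simp add: algebra_simps)
  thus "z_tilt y < 1" using s g
    unfolding z_tilt_def s_def[symmetric] x_def[symmetric] by (simp add: field_simps)
qed

text \<open>The point \<open>(s_hat y, y, x_hat y)\<close> is stationary for \<open>f_exp\<close> in \<open>x\<close> and in \<open>y\<close>, so only the variation through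
\<open>s\<close> survives: the derivative is \<open>s' * (- ln (z_tilt y))\<close>, a product of positive numbers.\<close>

lemma F_exp_derivative:
  assumes "0 < y" "y < real d * u * (1 - u)"
  obtains F' where "(F_exp d u has_real_derivative F') (at y)" "0 < F'"
proof -
  have y: "y < real d * u" using assms crossing_bound_less by simp
  let ?a = "real d * u - y" and ?b = "real d - real d * u - y"
  have ab: "0 < ?a" "0 < ?b" using free_half_edges_pos[OF y] by auto
  define X where "X = x_hat d u"
  define S where "S = s_hat d u"
  have x: "X y > 0" using x_hat_pos[OF y] X_def by simp
  have s: "0 < S y" "S y < 1 - u" using s_hat_pos[OF assms(1) y] s_hat_less_complement[OF assms] by (auto simp: S_def)
  have g: "(X y + 1) ^ d > 1" using x d by (intro one_less_power) auto
  obtain x' where x': "(X has_real_derivative x') (at y)" using x_hat_derivative[OF y] X_def by blast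
  obtain s' where s': "(S has_real_derivative s') (at y)" "0 < s'"
    using s_hat_derivative[OF assms(1) y] S_def by blast
  let ?g = "(X y + 1) ^ d - 1"
  define L where "L = x' / X y"
  define G where "G = real d * (X y + 1) ^ (d - 1) * x' / ?g"
  have dlx: "((\<lambda>y. ln (X y)) has_real_derivative L) (at y)"
    unfolding L_def using DERIV_chain2[OF DERIV_ln[OF x] x'] by (simp add: divide_inverse mult.commute)
  have "((\<lambda>y. (X y + 1) ^ d - 1) has_real_derivative real d * (X y + 1) ^ (d - 1) * x') (at y)"
    by (rule derivative_eq_intros x' refl | simp)+
  from DERIV_chain2[OF DERIV_ln this] g
  have dlg: "((\<lambda>y. ln ((X y + 1) ^ d - 1)) has_real_derivative G) (at y)"
    by (simp add: G_def divide_inverse mult.commute)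
  have db: "((\<lambda>y. xlnx (real d - real d * u - y)) has_real_derivative (ln ?b + 1) * - 1) (at y)"
    and da: "((\<lambda>y. xlnx (real d * u - y)) has_real_derivative (ln ?a + 1) * - 1) (at y)"
    by (rule xlnx_derivative; use ab in \<open>auto intro!: derivative_eq_intros\<close>)+
  have ds: "((\<lambda>y. xlnx (S y)) has_real_derivative (ln (S y) + 1) * s') (at y)"
    and dt: "((\<lambda>y. xlnx (1 - u - S y)) has_real_derivative (ln (1 - u - S y) + 1) * - s') (at y)"
    by (rule xlnx_derivative; use s s' in \<open>auto intro!: derivative_eq_intros\<close>)+
  have "((\<lambda>y. f_exp d u (S y) y (X y)) has_real_derivative
     - (ln ?b + 1) / 2 + (s' * ln ?g + S y * G) - (ln (X y) + y * L) - (ln (S y) + 1) * s'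
     + (ln (1 - u - S y) + 1) * s' + (ln ?a + 1) / 2) (at y)"
    unfolding f_exp_xlnx
    by (rule DERIV_cong, (rule db da ds dt dlx dlg s' DERIV_add DERIV_diff DERIV_mult DERIV_cdivide
          DERIV_const DERIV_ident)+) (simp add: field_simps)
  moreover have st: "S y * G = y * L"
  proof -
    have "S y = y * ?g / (X y * real d * (X y + 1) ^ (d - 1))" by (simp add: S_def X_def s_hat_def)
    moreover have "(X y + 1) ^ (d - 1) \<noteq> 0" using x by simp
    moreover have "?g \<noteq> 0" using g by simp
    ultimately show ?thesis unfolding G_def L_def using x d by (simp add: divide_simps mult_ac)
  qed
  moreover have lx: "ln (X y) = ln ?a / 2 - ln ?b / 2"
    using ab unfolding X_def x_hat_def by (simp add: ln_sqrt ln_div)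
  moreover have lz: "ln (z_tilt y) = ln (S y) - ln (1 - u - S y) - ln ?g"
    using s g by (simp add: z_tilt_def S_def[symmetric] X_def[symmetric] ln_div ln_mult add.commute)
  ultimately have "((\<lambda>y. f_exp d u (S y) y (X y)) has_real_derivative s' * (- ln (z_tilt y))) (at y)"
    by (elim DERIV_cong) (unfold st lx lz, simp add: field_simps)
  moreover have "ln (z_tilt y) < 0" using z_tilt_bounds[OF assms] by simp
  ultimately show ?thesis using that[of "s' * (- ln (z_tilt y))"] s'(2)
    unfolding F_exp_def[abs_def] X_def S_def by (simp add: mult_pos_neg)
qed

lemma continuous_on_F_exp: "continuous_on {0..real d * u * (1 - u)} (F_exp d u)"
proof -
  let ?I = "{0..real d * u * (1 - u)}"
  have I: "y < real d * u" if "y \<in> ?I" for y using that crossing_bound_less by auto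
  have b: "real d - real d * u - y > 0" if "y \<in> ?I" for y
    using free_half_edges_pos(2)[OF I[OF that]] .
  have cx: "continuous_on ?I (x_hat d u)"
    unfolding x_hat_def[abs_def] by (intro continuous_intros) (use b in force)
  have xp: "x_hat d u y > 0" if "y \<in> ?I" for y using x_hat_pos[OF I[OF that]] .
  have nz: "x_hat d u y \<noteq> 0" "x_hat d u y + 1 \<noteq> 0" "real d \<noteq> 0" if "y \<in> ?I" for y
    using xp[OF that] d by auto
  have g: "(x_hat d u y + 1) ^ d - 1 \<noteq> 0" if "y \<in> ?I" for y
  proof -
    have "1 < (x_hat d u y + 1) ^ d" using xp[OF that] d by (intro one_less_power) auto
    thus ?thesis by simp
  qed
  have cs: "continuous_on ?I (s_hat d u)"
    unfolding s_hat_def[abs_def] by (intro continuous_intros cx) (use nz in force)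
  show ?thesis
    unfolding F_exp_def[abs_def] f_exp_xlnx
    by (intro continuous_intros cx cs) (use g nz in force)+
qed

lemma neg_entropy: "xlnx u + xlnx (1 - u) < 0"
proof -
  have "u * ln u < 0" "(1 - u) * ln (1 - u) < 0" using u by (auto intro!: mult_pos_neg)
  thus ?thesis by (simp add: xlnx_def)
qed

text \<open>At \<open>y = 0\<close> the value is \<open>-(d/2 - 1)\<close> times the binary entropy of \<open>u\<close>; \<open>d \<ge> 3\<close> makes it negative.\<close>

lemma F_exp_0: "F_exp d u 0 < 0"
proof -
  have "real d - real d * u = real d * (1 - u)" by (simp add: algebra_simps)
  hence "F_exp d u 0 = (real d / 2 - 1) * (xlnx u + xlnx (1 - u))"
    using u by (simp add: F_exp_def f_exp_xlnx s_hat_def xlnx_mult)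
      (simp add: xlnx_def field_simps)
  thus ?thesis using neg_entropy d by (auto intro!: mult_pos_neg)
qed

text \<open>At the typical number of crossing edges the value is the binary entropy of \<open>u\<close>: nothing is lost
compared with counting all sets of density \<open>u\<close>.\<close>

lemma F_exp_right: "0 < F_exp d u (real d * u * (1 - u))"
proof -
  let ?y = "real d * u * (1 - u)"
  have u1: "1 - u > 0" using u by simp
  have a: "real d * u - ?y = real d * (u * u)" by (simp add: algebra_simps)
  have b: "real d - real d * u - ?y = real d * ((1 - u) * (1 - u))" by (simp add: algebra_simps)
  have "(real d * (u * u)) / (real d * ((1 - u) * (1 - u))) = (u / (1 - u))\<^sup>2"
    using d by (simp add: power2_eq_square)
  hence x: "x_hat d u ?y = u / (1 - u)" unfolding x_hat_def a b using u by (simp add: real_sqrt_abs)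
  have x1: "u / (1 - u) + 1 = 1 / (1 - u)" using u1 by (simp add: field_simps)
  \<comment> \<open>Here \<open>r\<close> is the chance that no half-edge of a vertex outside a typical set is matched into it.\<close>
  define r where "r = (1 - u) ^ d"
  have r: "0 < r" "r < 1" using u d by (auto simp: r_def power_less_one_iff)
  have g: "(u / (1 - u) + 1) ^ d - 1 = (1 - r) / r"
    unfolding x1 r_def using u1 by (simp add: power_divide field_simps)
  have s: "s_hat d u ?y = (1 - u) * (1 - r)"
  proof -
    define q where "q = (1 - u) ^ (d - 1)"
    have q: "0 < q" using u1 by (simp add: q_def)
    have rq: "r = (1 - u) * q" unfolding r_def q_def using d by (cases d) auto
    have "s_hat d u ?y = real d * u * (1 - u) * ((1 - r) / r) / (u / (1 - u) * real d * (1 / q))"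
      unfolding s_hat_def x g unfolding x1 q_def by (simp add: power_divide)
    also have "\<dots> = (1 - u) * (1 - r) * ((1 - u) * q / r)"
      using u u1 r q d by (simp add: divide_simps)
    also have "(1 - u) * q / r = 1" unfolding rq using u1 q by simp
    finally show ?thesis by simp
  qed
  have t: "1 - u - s_hat d u ?y = (1 - u) * r" unfolding s by (simp add: algebra_simps)
  have lr: "ln r = real d * ln (1 - u)" unfolding r_def using u1 by (simp add: ln_realpow)
  have lx: "ln (u / (1 - u)) = ln u - ln (1 - u)" using u by (simp add: ln_div)
  have lg: "ln ((1 - r) / r) = ln (1 - r) - ln r" using r by (simp add: ln_div)
  have "F_exp d u ?y = - (xlnx u + xlnx (1 - u))"
    unfolding F_exp_def f_exp_xlnx x t unfolding s g a b lx lg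
    using u u1 r d
    by (simp add: xlnx_mult) (simp add: xlnx_def lr ring_distribs, simp add: field_simps)
  thus ?thesis using neg_entropy by simp
qed

text \<open>The intermediate value theorem gives a zero and strict monotonicity its uniqueness, so the definite
description in \<open>y_bar\<close> denotes it.\<close>

lemma y_bar: "0 < y_bar d u" "y_bar d u < real d * u * (1 - u)" "F_exp d u (y_bar d u) = 0"
proof -
  let ?P = "\<lambda>y. 0 < y \<and> y < real d * u * (1 - u) \<and> s_hat d u y \<le> 1 - u \<and> F_exp d u y = 0"
  have "0 \<le> real d * u * (1 - u)" using u by simp
  then obtain y where y: "0 \<le> y" "y \<le> real d * u * (1 - u)" "F_exp d u y = 0"
    using IVT'[of "F_exp d u" 0 0 "real d * u * (1 - u)"] F_exp_0 F_exp_right continuous_on_F_exp by auto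
  have "y \<noteq> 0" "y \<noteq> real d * u * (1 - u)" using y F_exp_0 F_exp_right by auto
  hence yP: "?P y" using y s_hat_less_complement[of y] by auto
  have less: "F_exp d u y1 < F_exp d u y2"
    if "0 < y1" "y1 < y2" "y2 < real d * u * (1 - u)" for y1 y2
  proof (rule DERIV_pos_imp_increasing[OF that(2)])
    fix t assume "y1 \<le> t" "t \<le> y2"
    hence "0 < t" "t < real d * u * (1 - u)" using that by auto
    then obtain F' where "(F_exp d u has_real_derivative F') (at t)" "0 < F'" by (rule F_exp_derivative)
    thus "\<exists>F'. (F_exp d u has_real_derivative F') (at t) \<and> 0 < F'" by blast
  qed
  have "\<exists>!y. ?P y"
  proof (rule ex1I[of ?P, OF yP])
    fix y2 assume y2: "?P y2"
    show "y2 = y" using less[of y y2] less[of y2 y] yP y2 by (cases y y2 rule: linorder_cases) auto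
  qed
  from theI'[OF this] show "0 < y_bar d u" "y_bar d u < real d * u * (1 - u)" "F_exp d u (y_bar d u) = 0"
    unfolding y_bar_def by auto
qed

end

section \<open>The exponential rate of the first-moment bound\<close>

text \<open>The exponential growth rate, per vertex, of the Chernoff bound for sets of density \<open>u\<close> with \<open>y * n\<close>
crossing edges and fewer than \<open>l * u * n\<close> boundary vertices. Unlike \<open>f_exp\<close> it contains no size of the
boundary: that variable has been replaced by the fixed parameter \<open>z\<close>.\<close>

definition rate :: "nat \<Rightarrow> real \<Rightarrow> real \<Rightarrow> real \<Rightarrow> real \<Rightarrow> real \<Rightarrow> real" where
  "rate d l x z u y = xlnx (real d * u) + xlnx (real d - real d * u - y) / 2
     - xlnx (real d * u - y) / 2 - xlnx (real d) / 2 - y * ln x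
     + (1 - u) * ln (1 + z * ((1 + x) ^ d - 1)) - l * u * ln z - xlnx u - xlnx (1 - u)"

text \<open>The function \<open>c \<mapsto> (p + c) * ln ((p + c) / (p' + c))\<close> is nonincreasing, because \<open>ln t \<le> t - 1\<close>.\<close>

lemma mult_ln_ratio_le:
  fixes p q p' q' :: real
  assumes "0 \<le> p" "0 < p'" "p' \<le> q'" "q - q' = p - p'"
  shows "q * (ln q - ln q') \<le> p * (ln p - ln p')"
proof -
  define c where "c = q - p"
  have c: "0 \<le> c" "q = p + c" "q' = p' + c" using assms by (auto simp: c_def)
  show ?thesis
  proof (cases "p = 0")
    case True
    show ?thesis
    proof (cases "c = 0")
      case False
      hence "ln c \<le> ln (p' + c)" using c assms by (subst ln_le_cancel_iff) auto
      thus ?thesis using True c by (simp add: mult_nonneg_nonpos)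
    qed (use True c in auto)
  next
    case False
    let ?h = "\<lambda>c. (p + c) * (ln (p + c) - ln (p' + c))"
    have "?h c \<le> ?h 0"
    proof (rule DERIV_nonpos_imp_nonincreasing[OF c(1)])
      fix t :: real assume t: "0 \<le> t" "t \<le> c"
      hence pos: "p + t > 0" "p' + t > 0" using False assms by auto
      have "(?h has_real_derivative
          (ln (p + t) - ln (p' + t)) + (1 / (p + t) - 1 / (p' + t)) * (p + t)) (at t)"
        using pos by (auto intro!: derivative_eq_intros)
      moreover have "(1 / (p + t) - 1 / (p' + t)) * (p + t) = 1 - (p + t) / (p' + t)"
        using pos by (simp add: left_diff_distrib)
      moreover have "ln (p + t) - ln (p' + t) \<le> (p + t) / (p' + t) - 1"
        using pos ln_le_minus_one[of "(p + t) / (p' + t)"] by (simp add: ln_div)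
      ultimately show "\<exists>y. (?h has_real_derivative y) (at t) \<and> y \<le> 0" by force
    qed
    thus ?thesis using c by simp
  qed
qed

text \<open>Concavity of the rate in \<open>y\<close>, with \<open>y0\<close> as critical point, written as an inequality that also covers the
end point \<open>y = d * u\<close>. The hypothesis \<open>u \<le> 1/2\<close> enters as \<open>d * u \<le> d - d * u\<close>.\<close>

lemma rate_le_saddle:
  assumes "d \<ge> 3" "0 < u" "u \<le> 1/2" "0 \<le> y0" "y0 < real d * u" "0 \<le> y" "y \<le> real d * u"
  shows "rate d l (x_hat d u y0) z u y \<le> rate d l (x_hat d u y0) z u y0"
proof -
  let ?a = "real d * u" and ?b = "real d - real d * u"
  have ab: "?a \<le> ?b" using density_le_complement assms by blast
  have pos: "0 < ?a - y0" "0 < ?b - y0" using free_half_edges_pos[OF assms(1-3), of y0] assms by auto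
  have lx: "ln (x_hat d u y0) = ln (?a - y0) / 2 - ln (?b - y0) / 2"
    using pos unfolding x_hat_def by (simp add: ln_sqrt ln_div)
  have "(?b - y) * (ln (?b - y) - ln (?b - y0)) \<le> (?a - y) * (ln (?a - y) - ln (?a - y0))"
    by (rule mult_ln_ratio_le) (use assms ab pos in linarith)+
  thus ?thesis unfolding rate_def lx xlnx_def by (simp add: field_simps)
qed

text \<open>For \<open>z = z_tilt d u y\<close> the Chernoff bound in the size of the boundary is tight, so the rate is the exact
exponent \<open>f_exp\<close>.\<close>

lemma rate_saddle:
  assumes "d \<ge> 3" "0 < u" "u \<le> 1/2" "0 < y" "y < real d * u * (1 - u)"
  shows "rate d (s_hat d u y / u) (x_hat d u y) (z_tilt d u y) u y = F_exp d u y"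
proof -
  define s where "s = s_hat d u y"
  define g where "g = (1 + x_hat d u y) ^ d - 1"
  have y: "y < real d * u" using assms(5) crossing_bound_less[OF assms(1-3)] by linarith
  have x: "x_hat d u y > 0" using x_hat_pos[OF assms(1-3) y] .
  have s: "0 < s" "s < 1 - u" using s_hat_pos[OF assms(1-4) y] s_hat_less_complement[OF assms]
    by (auto simp: s_def)
  have g: "g > 0" using one_less_power[of "1 + x_hat d u y" d] x assms(1) by (simp add: g_def)
  have z: "z_tilt d u y = s / (1 - u - s) / g"
    unfolding z_tilt_def[OF assms(1-3)] s_def g_def ..
  have "z_tilt d u y * g = s / (1 - u - s)" unfolding z using g by simp
  moreover have "1 + s / (1 - u - s) = (1 - u) / (1 - u - s)" using s by (simp add: field_simps)
  ultimately have "1 + z_tilt d u y * g = (1 - u) / (1 - u - s)" by simp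
  hence l1: "ln (1 + z_tilt d u y * g) = ln (1 - u) - ln (1 - u - s)" using s assms by (simp add: ln_div)
  have l2: "ln (z_tilt d u y) = ln s - ln (1 - u - s) - ln g" unfolding z using s g by (simp add: ln_div ln_mult)
  show ?thesis
    unfolding rate_def F_exp_def f_exp_xlnx s_def[symmetric] g_def[symmetric] l1 l2
    using assms(2) unfolding g_def xlnx_def by (simp add: algebra_simps)
qed

lemma exists_negative_rate:
  assumes d: "d \<ge> 3" and u: "0 < u" "u \<le> 1/2" and l: "l < A_exp d u"
  obtains x z \<delta> where "0 < x" "0 < z" "z < 1" "0 < \<delta>"
    "\<forall>y\<in>{0..real d * u}. rate d l x z u y \<le> - \<delta>"
proof -
  define y0 where "y0 = y_bar d u"
  have y0: "0 < y0" "y0 < real d * u * (1 - u)" "F_exp d u y0 = 0"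
    using y_bar[OF d u] by (auto simp: y0_def)
  have y0': "y0 < real d * u" using y0(2) crossing_bound_less[OF d u] by linarith
  define x where "x = x_hat d u y0"
  define z where "z = z_tilt d u y0"
  have x: "0 < x" using x_hat_pos[OF d u y0'] x_def by simp
  have z: "0 < z" "z < 1" using z_tilt_bounds[OF d u y0(1,2)] z_def by auto
  \<comment> \<open>The amount by which the rate drops when \<open>A_exp d u\<close> is replaced by \<open>l\<close>.\<close>
  define \<delta> where "\<delta> = (A_exp d u - l) * u * (- ln z)"
  have \<delta>: "0 < \<delta>" unfolding \<delta>_def using l u z by (intro mult_pos_pos) auto
  have "rate d l x z u y \<le> - \<delta>" if y: "0 \<le> y" "y \<le> real d * u" for y
  proof -
    have "rate d l x z u y = rate d (A_exp d u) x z u y - \<delta>"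
      by (simp add: rate_def \<delta>_def algebra_simps)
    also have "rate d (A_exp d u) x z u y \<le> rate d (A_exp d u) x z u y0"
      unfolding x_def by (rule rate_le_saddle) (use d u y0 y0' y in auto)
    also have "\<dots> = 0"
      using rate_saddle[OF d u y0(1,2)] y0(3) by (simp add: A_exp_def x_def z_def y0_def)
    finally show ?thesis by simp
  qed
  thus ?thesis using that[OF x z \<delta>] by simp
qed

text \<open>The densities \<open>u n\<close> may exceed \<open>1/2\<close> when \<open>u0 = 1/2\<close>, where concavity fails. Hence negativity is
transported from the limit density by uniform continuity on a compact set, not proved afresh at each
density.\<close>

lemma rate_uniformly_negative:
  assumes d: "d \<ge> 3" and u: "0 < u" "u \<le> 1/2" and l: "l < A_exp d u"
  obtains x z \<delta> \<eta> where "0 < x" "0 < z" "z < 1" "0 < \<delta>" "0 < \<eta>"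
    "\<forall>u'\<in>{0..1}. \<forall>y\<in>{0..min (real d * u') (real d * (1 - u'))}.
       \<bar>u' - u\<bar> < \<eta> \<longrightarrow> rate d l x z u' y \<le> - \<delta>"
proof -
  obtain x z \<delta> where xz: "0 < x" "0 < z" "z < 1" "0 < \<delta>"
    and neg: "\<forall>y\<in>{0..real d * u}. rate d l x z u y \<le> - \<delta>"
    using exists_negative_rate[OF assms] .
  let ?K = "{0..1} \<times> {0..real d} :: (real \<times> real) set"
  have "continuous_on ?K (\<lambda>(u, y). rate d l x z u y)"
    unfolding rate_def case_prod_unfold by (intro continuous_intros) simp_all
  hence "uniformly_continuous_on ?K (\<lambda>(u, y). rate d l x z u y)"
    by (intro compact_uniformly_continuous compact_Times compact_Icc)
  then obtain \<epsilon> where \<epsilon>: "0 < \<epsilon>"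
    and close: "\<And>p q. p \<in> ?K \<Longrightarrow> q \<in> ?K \<Longrightarrow> dist q p < \<epsilon> \<Longrightarrow>
        dist ((\<lambda>(u, y). rate d l x z u y) q) ((\<lambda>(u, y). rate d l x z u y) p) < \<delta> / 2"
    using xz unfolding uniformly_continuous_on_def by (meson half_gt_zero)
  define \<eta> where "\<eta> = \<epsilon> / (1 + real d)"
  have \<eta>: "0 < \<eta>" using \<epsilon> by (simp add: \<eta>_def)
  have "rate d l x z u' y \<le> - (\<delta> / 2)"
    if A: "\<bar>u' - u\<bar> < \<eta>" "0 \<le> u'" "u' \<le> 1" "0 \<le> y" "y \<le> real d * u'" "y \<le> real d * (1 - u')" for u' y
  proof -
    \<comment> \<open>For \<open>u' > u\<close> the value \<open>y\<close> may lie outside the range where the rate at \<open>u\<close> is controlled; moving it back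
      into that range changes it by at most \<open>d * \<bar>u' - u\<bar>\<close>, which the factor \<open>1 + d\<close> in \<open>\<eta>\<close> accounts for.\<close>
    define y' where "y' = min y (real d * u)"
    have y': "0 \<le> y'" "y' \<le> real d * u" "y' \<le> y" using A u by (auto simp: y'_def)
    have yd: "y \<le> real d" using A(5) mult_left_mono[OF A(3), of "real d"] by simp
    have "\<bar>y - y'\<bar> \<le> real d * \<bar>u' - u\<bar>"
    proof (cases "y \<le> real d * u")
      case False
      hence "\<bar>y - y'\<bar> = y - real d * u" by (simp add: y'_def)
      also have "\<dots> \<le> real d * (u' - u)" using A by (simp add: algebra_simps)
      also have "\<dots> \<le> real d * \<bar>u' - u\<bar>" by (intro mult_left_mono) auto
      finally show ?thesis .
    qed (simp add: y'_def)
    moreover have "dist (u', y) (u, y') \<le> \<bar>u' - u\<bar> + \<bar>y - y'\<bar>"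
      unfolding dist_Pair_Pair dist_real_def by (rule sqrt_sum_squares_le_sum_abs[THEN order_trans]) simp
    ultimately have "dist (u', y) (u, y') \<le> (1 + real d) * \<bar>u' - u\<bar>" by (simp add: algebra_simps)
    also have "\<dots> < (1 + real d) * \<eta>" using A by (intro mult_strict_left_mono) auto
    also have "\<dots> = \<epsilon>" by (simp add: \<eta>_def)
    finally have "dist (rate d l x z u' y) (rate d l x z u y') < \<delta> / 2"
      using close[of "(u, y')" "(u', y)"] A u y' yd by auto
    moreover have "rate d l x z u y' \<le> - \<delta>" using neg y' by simp
    ultimately show ?thesis unfolding dist_real_def by linarith
  qed
  thus ?thesis using that[of x z "\<delta> / 2" \<eta>] xz \<eta> by simp
qed

section \<open>Asymptotics of the first moment\<close>

lemma ln_fact_ge: "xlnx (real m) - real m \<le> ln (fact m)"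
proof (induction m)
  case (Suc m)
  show ?case
  proof (cases "m = 0")
    case False
    hence m: "real m > 0" by simp
    have "ln ((real m + 1) / real m) \<le> (real m + 1) / real m - 1"
      using m by (intro ln_le_minus_one) auto
    also have "\<dots> = 1 / real m" using m by (simp add: field_simps)
    finally have "real m * (ln (real m + 1) - ln (real m)) \<le> real m * (1 / real m)"
      using m by (intro mult_left_mono) (auto simp: ln_div)
    hence "real m * ln (real m + 1) - real m * ln (real m) \<le> 1" using m by (simp add: right_diff_distrib)
    moreover have "ln (fact (Suc m)) = ln (real m + 1) + ln (fact m)"
      by (simp add: ln_mult add.commute)
    moreover have "xlnx (real (Suc m)) = real m * ln (real m + 1) + ln (real m + 1)"
      by (simp add: xlnx_def algebra_simps)
    ultimately show ?thesis using Suc by (simp add: xlnx_def)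
  qed (simp add: xlnx_def)
qed (simp add: xlnx_def)

lemma ln_fact_le: "ln (fact m) \<le> xlnx (real m) - real m + 1 + ln (real m + 1)"
proof -
  have "ln (fact m) \<le> xlnx (real m) - real m + 1 + ln (real m)"
  proof (induction m)
    case (Suc m)
    show ?case
    proof (cases "m = 0")
      case False
      hence m: "real m > 0" by simp
      have "ln (real m / (real m + 1)) \<le> real m / (real m + 1) - 1"
        using m by (intro ln_le_minus_one) auto
      also have "\<dots> = - (1 / (real m + 1))" using m by (simp add: field_simps)
      finally have "(real m + 1) * (ln (real m) - ln (real m + 1)) \<le> (real m + 1) * - (1 / (real m + 1))"
        using m by (intro mult_left_mono) (auto simp: ln_div)
      also have "\<dots> = - 1" using m by simp
      finally have "real m * ln (real m) + ln (real m) + 1 \<le> real m * ln (real m + 1) + ln (real m + 1)"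
        by (simp add: algebra_simps)
      moreover have "ln (fact (Suc m)) = ln (real m + 1) + ln (fact m)"
        by (simp add: ln_mult add.commute)
      moreover have "xlnx (real (Suc m)) = real m * ln (real m + 1) + ln (real m + 1)"
        by (simp add: xlnx_def algebra_simps)
      ultimately show ?thesis using Suc by (simp add: xlnx_def add.commute)
    qed (simp add: xlnx_def)
  qed (simp add: xlnx_def)
  moreover have "ln (real m) \<le> ln (real m + 1)" by (cases "m = 0") auto
  ultimately show ?thesis by linarith
qed

lemma falling_prod_fact: "y \<le> a \<Longrightarrow> (\<Prod>i<y. a - i) * fact (a - y) = (fact a :: nat)"
proof (induction y)
  case (Suc y)
  have "fact (a - y) = (a - y) * fact (a - Suc y)"
    using Suc.prems by (metis Suc_diff_Suc Suc_le_lessD diff_Suc_1 fact_Suc of_nat_id)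
  thus ?case using Suc by (simp add: mult.assoc)
qed simp

lemma matching_number_le_exp: "real (matching_number m) \<le> exp (ln (fact m) / 2)"
proof (rule power2_le_imp_le)
  have "(exp (ln (fact m) / 2))\<^sup>2 = exp (ln (fact m :: real))" by (simp add: power2_eq_square flip: exp_add)
  also have "\<dots> = real (fact m)" by simp
  finally show "(real (matching_number m))\<^sup>2 \<le> (exp (ln (fact m) / 2))\<^sup>2"
    using of_nat_mono[OF matching_number_square_le_fact[of m], where 'a = real] by simp
qed simp

lemma exp_le_matching_number:
  assumes "even m"
  shows "exp (ln (fact m) / 2 - ln (real m + 1) / 2) \<le> real (matching_number m)"
proof (rule power2_le_imp_le)
  have "(exp (ln (fact m) / 2 - ln (real m + 1) / 2))\<^sup>2 = exp (ln (fact m) - ln (real m + 1))"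
    by (simp add: power2_eq_square flip: exp_add)
  also have "\<dots> = fact m / (real m + 1)" by (simp add: exp_diff)
  also have "\<dots> \<le> (real (matching_number m))\<^sup>2"
    using of_nat_mono[OF fact_le_matching_number_square[OF assms], where 'a = real]
    by (simp add: divide_simps algebra_simps)
  finally show "(exp (ln (fact m) / 2 - ln (real m + 1) / 2))\<^sup>2 \<le> (real (matching_number m))\<^sup>2" .
qed simp

text \<open>In terms of factorials the ratio of the two counts is a product of factorials to powers \<open>1\<close>, \<open>-1/2\<close>, \<open>1/2\<close>
and \<open>-1/2\<close>; the linear terms of Stirling's estimate cancel.\<close>

lemma crossing_weight_le:
  assumes "y \<le> a" "y \<le> b" "even (a + b)"
  shows "real (crossing_weight a b y) \<le> real (matching_number (a + b)) *
    exp (xlnx (real a) - xlnx (real a - real y) / 2 + xlnx (real b - real y) / 2 - xlnx (real (a + b)) / 2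
         + 2 + 2 * ln (real (a + b) + 1))"
proof -
  let ?L = "\<lambda>m. ln (fact m :: real)"
  have prod: "real (\<Prod>i<y. a - i) = exp (?L a - ?L (a - y))"
    using arg_cong[OF falling_prod_fact[OF assms(1)], of real] by (simp add: exp_diff field_simps)
  have "real (crossing_weight a b y) \<le> exp (?L a - ?L (a - y)) * exp (?L (a - y) / 2) * exp (?L (b - y) / 2)"
    unfolding crossing_weight_def of_nat_mult prod
    by (intro mult_mono matching_number_le_exp) auto
  also have "\<dots> = exp (?L (a + b) / 2 - ln (real (a + b) + 1) / 2) *
      exp (?L a - ?L (a - y) / 2 + ?L (b - y) / 2 - ?L (a + b) / 2 + ln (real (a + b) + 1) / 2)"
    unfolding exp_add[symmetric] by (simp add: field_simps)
  also have "\<dots> \<le> real (matching_number (a + b)) *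
    exp (xlnx (real a) - xlnx (real a - real y) / 2 + xlnx (real b - real y) / 2 - xlnx (real (a + b)) / 2
         + 2 + 2 * ln (real (a + b) + 1))"
  proof (rule mult_mono)
    have l: "ln (real a + 1) \<le> ln (real (a + b) + 1)" "ln (real (b - y) + 1) \<le> ln (real (a + b) + 1)"
      by (subst ln_le_cancel_iff; simp)+
    have "?L a \<le> xlnx (real a) - real a + 1 + ln (real a + 1)" by (rule ln_fact_le)
    moreover have "?L (b - y) \<le> xlnx (real b - real y) - (real b - real y) + 1 + ln (real (b - y) + 1)"
      using ln_fact_le[of "b - y"] assms by (simp add: of_nat_diff)
    moreover have "xlnx (real a - real y) - (real a - real y) \<le> ?L (a - y)"
      using ln_fact_ge[of "a - y"] assms by (simp add: of_nat_diff)
    moreover have "xlnx (real (a + b)) - (real a + real b) \<le> ?L (a + b)"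
      using ln_fact_ge[of "a + b"] by simp
    ultimately have "?L a - ?L (a - y) / 2 + ?L (b - y) / 2 - ?L (a + b) / 2 + ln (real (a + b) + 1) / 2
        \<le> xlnx (real a) - xlnx (real a - real y) / 2 + xlnx (real b - real y) / 2 - xlnx (real (a + b)) / 2
         + 2 + 2 * ln (real (a + b) + 1)" using l by argo
    thus "exp (?L a - ?L (a - y) / 2 + ?L (b - y) / 2 - ?L (a + b) / 2 + ln (real (a + b) + 1) / 2)
      \<le> exp (xlnx (real a) - xlnx (real a - real y) / 2 + xlnx (real b - real y) / 2 - xlnx (real (a + b)) / 2
         + 2 + 2 * ln (real (a + b) + 1))" by simp
  qed (use exp_le_matching_number[OF assms(3)] in auto)
  finally show ?thesis .
qed

text \<open>One term of the expansion of \<open>(u + (1 - u)) ^ n = 1\<close>.\<close>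

lemma binomial_le_entropy:
  assumes "0 < k" "k < n"
  shows "real (n choose k) \<le> exp (real n * (- xlnx (real k / real n) - xlnx (1 - real k / real n)))"
proof -
  define u where "u = real k / real n"
  have u: "0 < u" "u < 1" using assms by (auto simp: u_def)
  have nk: "real n * u = real k" "real n * (1 - u) = real (n - k)"
    using assms by (auto simp: u_def field_simps of_nat_diff)
  have "real (n choose k) * (u ^ k * (1 - u) ^ (n - k)) \<le> (\<Sum>j\<le>n. real (n choose j) * u ^ j * (1 - u) ^ (n - j))"
    using assms u by (subst mult.assoc[symmetric], intro member_le_sum) auto
  also have "\<dots> = (u + (1 - u)) ^ n" by (rule binomial_ring[symmetric])
  also have "\<dots> = 1" by simp
  finally have "real (n choose k) \<le> 1 / (u ^ k * (1 - u) ^ (n - k))" using u by (simp add: field_simps)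
  also have "u ^ k * (1 - u) ^ (n - k) = exp (real k * ln u + real (n - k) * ln (1 - u))"
    using u by (simp add: exp_add exp_of_nat_mult)
  also have "1 / \<dots> = exp (- (real k * ln u + real (n - k) * ln (1 - u)))" by (simp only: exp_minus inverse_eq_divide)
  also have "- (real k * ln u + real (n - k) * ln (1 - u)) = real n * (- xlnx u - xlnx (1 - u))"
    unfolding nk[symmetric] xlnx_def by (simp add: algebra_simps)
  finally show ?thesis unfolding u_def .
qed

text \<open>The parameter \<open>w\<close> of \<open>card_poorly_expanding\<close> is chosen so that its hypothesis is the assumed bound on the
rate. The powers of \<open>n\<close> that arise from rescaling \<open>xlnx\<close> cancel.\<close>

lemma card_poorly_expanding_le:
  assumes n: "0 < k" "k < n" and ev: "even (d * n)" and xz: "0 < x" "0 < z" "z < 1"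
    and rate: "\<And>y. 0 \<le> y \<Longrightarrow> y \<le> real d * (real k / real n) \<Longrightarrow> y \<le> real d * (1 - real k / real n)
        \<Longrightarrow> rate d l x z (real k / real n) y \<le> - \<delta>"
  shows "real (card (poorly_expanding n d k (l * real k)))
    \<le> real (matching_number (d * n)) * exp (- \<delta> * real n + 2 + 2 * ln (real (d * n) + 1))"
proof -
  define N where "N = real n"
  define u where "u = real k / N"
  define G where "G = 1 + z * ((1 + x) ^ d - 1)"
  define R where "R = (1 - u) * ln G - l * u * ln z - xlnx u - xlnx (1 - u)"
  define e where "e = 2 + 2 * ln (real (d * n) + 1)"
  define w where "w = real (matching_number (d * n)) * exp (- \<delta> * N + e - N * R)"
  have N: "0 < N" using n by (simp add: N_def)
  have u: "0 < u" "u < 1" using n by (auto simp: u_def N_def)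
  have Nu: "real k = N * u" "real (n - k) = N * (1 - u)" "real k = N * u"
    using n N by (auto simp: u_def N_def field_simps of_nat_diff)
  have "1 \<le> (1 + x) ^ d" using xz by (intro one_le_power) auto
  hence G: "0 < G" unfolding G_def using xz by (intro add_pos_nonneg mult_nonneg_nonneg) auto
  have "real (card (poorly_expanding n d k (l * real k)))
      \<le> real (n choose k) * (w * z powr (- (l * real k)) * (1 + z * ((1 + x) ^ d - 1)) ^ (n - k))"
  proof (rule card_poorly_expanding[OF xz(1,2)])
    fix y assume y: "y \<le> d * k" "y \<le> d * (n - k)"
    define t where "t = real y / N"
    have yt: "real y = N * t" using N by (simp add: t_def)
    have "real y \<le> real d * real k" "real y \<le> real d * real (n - k)"
      using of_nat_mono[OF y(1), where 'a = real] of_nat_mono[OF y(2), where 'a = real] by simp_all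
    hence "N * t \<le> N * (real d * u)" "N * t \<le> N * (real d * (1 - u))"
      unfolding yt Nu by (simp_all add: mult_ac)
    hence t: "t \<le> real d * u" "t \<le> real d * (1 - u)" by (simp_all only: mult_le_cancel_left_pos[OF N])
    have t0: "0 \<le> t" using N by (simp add: t_def)
    have ab: "d * k + d * (n - k) = d * n" using n by (simp flip: distrib_left)
    have rt: "rate d l x z u t \<le> - \<delta>" using rate[of t] t t0 unfolding u_def N_def by simp
    have "real (crossing_weight (d * k) (d * (n - k)) y) \<le> real (matching_number (d * n)) *
      exp (xlnx (real (d * k)) - xlnx (real (d * k) - real y) / 2 + xlnx (real (d * (n - k)) - real y) / 2
         - xlnx (real (d * n)) / 2 + e)"
      using crossing_weight_le[OF y] ev unfolding ab e_def by (simp add: add.assoc)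
    also have "xlnx (real (d * k)) - xlnx (real (d * k) - real y) / 2 + xlnx (real (d * (n - k)) - real y) / 2
         - xlnx (real (d * n)) / 2 = N * (rate d l x z u t + t * ln x - R)"
    proof -
      have 1: "real (d * k) = N * (real d * u)" "real (d * k) - real y = N * (real d * u - t)"
        "real (d * (n - k)) - real y = N * (real d - real d * u - t)" "real (d * n) = N * real d"
        unfolding of_nat_mult Nu yt N_def[symmetric] by (simp_all add: algebra_simps)
      have 2: "0 \<le> real d - real d * u - t" using t by (simp add: algebra_simps)
      have "xlnx (real (d * k)) = real d * u * xlnx N + N * xlnx (real d * u)"
        unfolding 1(1) using N u by (intro xlnx_mult) auto
      moreover have "xlnx (real (d * k) - real y) = (real d * u - t) * xlnx N + N * xlnx (real d * u - t)"
        unfolding 1(2) using N t by (intro xlnx_mult) auto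
      moreover have "xlnx (real (d * (n - k)) - real y)
          = (real d - real d * u - t) * xlnx N + N * xlnx (real d - real d * u - t)"
        unfolding 1(3) using N 2 by (intro xlnx_mult) auto
      moreover have "xlnx (real (d * n)) = real d * xlnx N + N * xlnx (real d)"
        unfolding 1(4) using N by (intro xlnx_mult) auto
      ultimately show ?thesis unfolding rate_def R_def G_def by (simp add: field_simps)
    qed
    also have "real (matching_number (d * n)) * exp (N * (rate d l x z u t + t * ln x - R) + e)
        \<le> real (matching_number (d * n)) * exp (N * (- \<delta> + t * ln x - R) + e)"
      using N rt by (intro mult_left_mono) auto
    also have "\<dots> = w * x ^ y"
    proof -
      have "x ^ y = exp (real y * ln x)" using xz by (simp add: exp_of_nat_mult)
      hence "w * x ^ y = real (matching_number (d * n)) * exp (- \<delta> * N + e - N * R + N * t * ln x)"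
        unfolding w_def yt by (simp add: exp_add)
      thus ?thesis by (simp add: algebra_simps)
    qed
    finally show "real (crossing_weight (d * k) (d * (n - k)) y) \<le> w * x ^ y" .
  qed (use xz in auto)
  also have "\<dots> \<le> exp (N * (- xlnx u - xlnx (1 - u))) * (w * z powr (- (l * real k)) * (1 + z * ((1 + x) ^ d - 1)) ^ (n - k))"
    using binomial_le_entropy[OF n] G unfolding u_def N_def G_def
    by (intro mult_right_mono mult_nonneg_nonneg) (auto simp: w_def)
  also have "\<dots> = real (matching_number (d * n)) * exp (- \<delta> * N + e)"
  proof -
    have z: "z powr (- (l * real k)) = exp (- (l * (N * u)) * ln z)"
      using xz by (simp add: powr_def Nu)
    have g: "(1 + z * ((1 + x) ^ d - 1)) ^ (n - k) = exp (N * (1 - u) * ln G)"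
      unfolding G_def[symmetric] Nu(2)[symmetric] using G by (simp add: exp_of_nat_mult)
    show ?thesis unfolding z g w_def R_def
      by (simp add: mult.left_commute[of "exp _"] mult.assoc flip: exp_add) (simp add: algebra_simps)
  qed
  finally show ?thesis unfolding N_def e_def by (simp only: add.assoc)
qed

section \<open>Random regular graphs\<close>

lemma card_bad_regular_graphs_le:
  assumes d: "d \<ge> 1" and n: "n > 32 * d"
  shows "real (card {E \<in> regular_graphs n d. \<exists>U\<subseteq>{..<n}. card U = k \<and> real (card (vertex_boundary E U)) < b})
      * real (matching_number (d * n))
    \<le> 2 * (1 + real (d * n) ^ 8) ^ (12 * d\<^sup>2) * real (card (poorly_expanding n d k b)) * real (card (regular_graphs n d))"
proof -
  let ?bad = "\<lambda>E. \<exists>U\<subseteq>{..<n}. card U = k \<and> real (card (vertex_boundary E U)) < b"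
  let ?B = "{E \<in> regular_graphs n d. ?bad E}"
  let ?C = "2 * (1 + (d * n) ^ 8) ^ (12 * d\<^sup>2)"
  have "{M \<in> simple_matchings n d. ?bad (underlying_graph M)} \<subseteq> poorly_expanding n d k b"
    by (auto simp: simple_matchings_def poorly_expanding_def vertex_boundary_underlying_graph)
  hence "card {M \<in> simple_matchings n d. ?bad (underlying_graph M)} \<le> card (poorly_expanding n d k b)"
    unfolding poorly_expanding_def
    by (intro card_mono finite_perfect_matchings_Collect finite_half_edges)
  hence 1: "fact d ^ n * card ?B \<le> card (poorly_expanding n d k b)"
    unfolding card_simple_matchings_Collect[of n d ?bad] .
  have 2: "card (simple_matchings n d) = fact d ^ n * card (regular_graphs n d)"
    using card_simple_matchings_Collect[of n d "\<lambda>_. True"] by simp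
  have "fact d ^ n * (card ?B * matching_number (d * n)) \<le> (fact d ^ n * card ?B) * (?C * card (simple_matchings n d))"
    using matching_number_le_simple[OF d n] by (simp add: mult.assoc)
  also have "\<dots> \<le> card (poorly_expanding n d k b) * (?C * card (simple_matchings n d))"
    using 1 by (rule mult_right_mono) simp
  also have "\<dots> = fact d ^ n * (?C * card (poorly_expanding n d k b) * card (regular_graphs n d))"
    unfolding 2 by (simp only: mult_ac)
  finally have "card ?B * matching_number (d * n) \<le> ?C * card (poorly_expanding n d k b) * card (regular_graphs n d)"
    by simp
  from of_nat_mono[OF this, where 'a = real] show ?thesis by simp
qed

lemma regular_graphs_nonempty:
  assumes "d \<ge> 1" "n > 32 * d" "even (d * n)"
  shows "regular_graphs n d \<noteq> {}"
proof
  assume "regular_graphs n d = {}"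
  hence "card (simple_matchings n d) = 0"
    using card_simple_matchings_Collect[of n d "\<lambda>_. True"] by simp
  thus False using matching_number_le_simple[OF assms(1,2)] matching_number_pos[OF assms(3)] by simp
qed

lemma min_vertex_expansion_ge_iff:
  assumes "real k = r * real n" "k \<le> n" "0 < k"
  shows "l \<le> min_vertex_expansion r n E \<longleftrightarrow>
    (\<forall>U\<subseteq>{..<n}. card U = k \<longrightarrow> l * real k \<le> real (card (vertex_boundary E U)))"
proof -
  let ?S = "{U. U \<subseteq> {..<n} \<and> real (card U) = r * real n}"
  have S: "?S = {U. U \<subseteq> {..<n} \<and> card U = k}" unfolding assms(1)[symmetric] by simp
  have "{..<k} \<in> ?S" unfolding S using assms by auto
  hence ne: "?S \<noteq> {}" by blast
  have fin: "finite ?S" by simp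
  have "l \<le> min_vertex_expansion r n E \<longleftrightarrow>
      (\<forall>U\<in>?S. l \<le> real (card (vertex_boundary E U)) / (r * real n))"
    unfolding min_vertex_expansion_def using fin ne by (subst Min_ge_iff) auto
  also have "\<dots> \<longleftrightarrow> (\<forall>U\<subseteq>{..<n}. card U = k \<longrightarrow> l * real k \<le> real (card (vertex_boundary E U)))"
    unfolding S assms(1)[symmetric] using assms(3) by (auto simp: field_simps)
  finally show ?thesis .
qed

lemma prob_min_vertex_expansion_ge:
  assumes d: "d \<ge> 1" and n: "n > 32 * d" and ev: "even (d * n)"
    and k: "real k = r * real n" "0 < k" "k < n"
    and bound: "real (card (poorly_expanding n d k (l * real k))) \<le> real (matching_number (d * n)) * q"
  shows "measure_pmf.prob (random_regular_graph n d) {E. l \<le> min_vertex_expansion r n E}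
      \<ge> 1 - 2 * (1 + real (d * n) ^ 8) ^ (12 * d\<^sup>2) * q"
proof -
  let ?R = "regular_graphs n d" and ?good = "{E. l \<le> min_vertex_expansion r n E}"
  let ?c = "2 * (1 + real (d * n) ^ 8) ^ (12 * d\<^sup>2)"
  have ne: "?R \<noteq> {}" using regular_graphs_nonempty[OF d n ev] .
  have cR: "real (card ?R) > 0" using ne finite_regular_graphs by (simp add: card_gt_0_iff)
  have pm: "real (matching_number (d * n)) > 0" using matching_number_pos[OF ev] by simp
  let ?B = "{E \<in> ?R. \<exists>U\<subseteq>{..<n}. card U = k \<and> real (card (vertex_boundary E U)) < l * real k}"
  have B: "?R \<inter> - ?good = ?B"
    using min_vertex_expansion_ge_iff[OF k(1) less_imp_le[OF k(3)] k(2), of l] by (auto simp: not_le)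
  have "real (card ?B) * real (matching_number (d * n)) \<le> ?c * real (card (poorly_expanding n d k (l * real k))) * real (card ?R)"
    by (rule card_bad_regular_graphs_le[OF d n])
  also have "\<dots> \<le> ?c * (real (matching_number (d * n)) * q) * real (card ?R)"
    using bound by (intro mult_right_mono mult_left_mono) auto
  finally have "real (card ?B) * real (matching_number (d * n)) \<le> (?c * q * real (card ?R)) * real (matching_number (d * n))"
    by (simp only: mult_ac)
  hence "real (card ?B) \<le> ?c * q * real (card ?R)" using pm by (simp only: mult_le_cancel_right_pos)
  hence "real (card ?B) / real (card ?R) \<le> ?c * q" using cR by (simp add: pos_divide_le_eq)
  moreover have "measure_pmf.prob (random_regular_graph n d) (- ?good) = real (card ?B) / real (card ?R)"
    unfolding random_regular_graph_def measure_pmf_of_set[OF ne finite_regular_graphs] B ..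
  moreover have "measure_pmf.prob (random_regular_graph n d) ?good = 1 - measure_pmf.prob (random_regular_graph n d) (- ?good)"
    using measure_pmf.prob_compl[of ?good "random_regular_graph n d"] by (simp add: Compl_eq_Diff_UNIV)
  ultimately show ?thesis by linarith
qed

section \<open>Expansion asymptotically almost surely\<close>

lemma eventually_admissible_orders:
  "eventually P (admissible_orders d) \<longleftrightarrow> eventually (\<lambda>n. even (d * n) \<longrightarrow> P n) sequentially"
  by (simp add: admissible_orders_def eventually_inf_principal)

lemma admissible_orders_neq_bot: "admissible_orders d \<noteq> bot"
proof
  assume "admissible_orders d = bot"
  hence "eventually (\<lambda>_. False) (admissible_orders d)" by simp
  then obtain n0 where "\<And>n. n \<ge> n0 \<Longrightarrow> odd (d * n)"
    unfolding eventually_admissible_orders eventually_sequentially by auto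
  from this[of "2 * n0"] show False by simp
qed

lemma filterlim_admissible_orders: "filterlim (\<lambda>n. n) sequentially (admissible_orders d)"
  unfolding admissible_orders_def by (rule filterlim_mono[OF filterlim_ident order_refl inf_le1])

lemma one_plus_power_le:
  fixes m :: real
  assumes "0 \<le> m"
  shows "1 + m ^ Suc k \<le> (1 + m) ^ Suc k"
proof (induction k)
  case (Suc k)
  have "1 + m ^ Suc (Suc k) \<le> (1 + m) * (1 + m ^ Suc k)" using assms by (simp add: algebra_simps)
  also have "\<dots> \<le> (1 + m) * (1 + m) ^ Suc k" using Suc assms by (intro mult_left_mono) auto
  finally show ?case by simp
qed simp

lemma failure_probability_tendsto_0:
  assumes "\<delta> > 0" "d \<ge> 1"
  shows "((\<lambda>n. 2 * (1 + real (d * n) ^ 8) ^ (12 * d\<^sup>2) * exp (- \<delta> * real n + 2 + 2 * ln (real (d * n) + 1)))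
      \<longlongrightarrow> 0) sequentially"
proof (rule tendsto_sandwich[OF _ _ tendsto_const])
  define c D :: real where "c = 8 * real (12 * d\<^sup>2) + 2" and "D = real d"
  have "c > 0" "D > 0" using assms by (auto simp: c_def D_def intro!: add_nonneg_pos)
  thus "((\<lambda>n. 2 * exp (- \<delta> * real n + 2 + c * ln (D * real n + 1))) \<longlongrightarrow> 0) sequentially"
    using assms(1) by real_asymp
  show "eventually (\<lambda>n. 2 * (1 + real (d * n) ^ 8) ^ (12 * d\<^sup>2) * exp (- \<delta> * real n + 2 + 2 * ln (real (d * n) + 1))
      \<le> 2 * exp (- \<delta> * real n + 2 + c * ln (D * real n + 1))) sequentially"
  proof (rule always_eventually, rule allI)
    fix n
    define m where "m = real (d * n)"
    have m: "0 \<le> m" by (simp add: m_def)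
    have "1 + m ^ 8 \<le> (1 + m) ^ 8" using one_plus_power_le[OF m, of 7] by simp
    hence "(1 + m ^ 8) ^ (12 * d\<^sup>2) \<le> ((1 + m) ^ 8) ^ (12 * d\<^sup>2)" using m by (intro power_mono) auto
    also have "\<dots> = exp (8 * real (12 * d\<^sup>2) * ln (1 + m))"
    proof -
      have "exp (real (8 * (12 * d\<^sup>2)) * ln (1 + m)) = (1 + m) ^ (8 * (12 * d\<^sup>2))"
        using m by (simp only: exp_of_nat_mult) simp
      thus ?thesis by (simp only: power_mult of_nat_mult of_nat_numeral)
    qed
    finally have "2 * (1 + m ^ 8) ^ (12 * d\<^sup>2) * exp (- \<delta> * real n + 2 + 2 * ln (m + 1))
        \<le> 2 * exp (8 * real (12 * d\<^sup>2) * ln (1 + m)) * exp (- \<delta> * real n + 2 + 2 * ln (m + 1))"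
      by (intro mult_right_mono mult_left_mono) auto
    also have "\<dots> = 2 * exp (- \<delta> * real n + 2 + c * ln (m + 1))"
      by (simp add: c_def algebra_simps flip: exp_add)
    finally show "2 * (1 + real (d * n) ^ 8) ^ (12 * d\<^sup>2) * exp (- \<delta> * real n + 2 + 2 * ln (real (d * n) + 1))
      \<le> 2 * exp (- \<delta> * real n + 2 + c * ln (D * real n + 1))"
      unfolding m_def D_def by simp
  qed
qed (auto intro!: always_eventually)

lemma set_size_from_density:
  assumes "0 < r" "r * real n \<in> \<int>" "0 < n"
  obtains k where "real k = r * real n" "0 < k"
proof -
  from assms(2) obtain i where i: "r * real n = of_int i" by (rule Ints_cases)
  have "0 < r * real n" using assms by simp
  hence "0 < i" using i by simp
  thus ?thesis using that[of "nat i"] i by simp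
qed

lemma aas_expansion_below_A:
  assumes d: "d \<ge> 3" and u0: "0 < u0" "u0 \<le> 1/2"
    and u: "\<forall>n. even (d * n) \<longrightarrow> 0 < u n \<and> u n \<le> 1 \<and> u n * real n \<in> \<int>"
    and lim: "(u \<longlongrightarrow> u0) (admissible_orders d)"
    and l: "l < A_exp d u0"
  shows "aas_regular d (\<lambda>n E. min_vertex_expansion (u n) n E \<ge> l)"
proof -
  obtain x z \<delta> \<eta> where xz: "0 < x" "0 < z" "z < 1" "0 < \<delta>" "0 < \<eta>"
    and neg: "\<forall>u'\<in>{0..1}. \<forall>y\<in>{0..min (real d * u') (real d * (1 - u'))}.
       \<bar>u' - u0\<bar> < \<eta> \<longrightarrow> rate d l x z u' y \<le> - \<delta>"
    using rate_uniformly_negative[OF d u0 l] .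
  let ?p = "\<lambda>n. measure_pmf.prob (random_regular_graph n d) {E. l \<le> min_vertex_expansion (u n) n E}"
  let ?q = "\<lambda>n. 2 * (1 + real (d * n) ^ 8) ^ (12 * d\<^sup>2) * exp (- \<delta> * real n + 2 + 2 * ln (real (d * n) + 1))"
  \<comment> \<open>The bound \<open>1/2\<close> keeps \<open>u n\<close> below \<open>1\<close>.\<close>
  have "eventually (\<lambda>n. \<bar>u n - u0\<bar> < min \<eta> (1/2)) (admissible_orders d)"
    using tendstoD[OF lim, of "min \<eta> (1/2)"] xz by (simp add: dist_real_def)
  moreover have "eventually (\<lambda>n. n > 32 * d) (admissible_orders d)"
    unfolding eventually_admissible_orders
    using eventually_gt_at_top[of "32 * d"] by eventually_elim simp
  moreover have "eventually (\<lambda>n. even (d * n)) (admissible_orders d)"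
    unfolding eventually_admissible_orders by simp
  ultimately have lower: "eventually (\<lambda>n. 1 - ?q n \<le> ?p n) (admissible_orders d)"
  proof eventually_elim
    case (elim n)
    have n0: "0 < n" using elim by simp
    have un: "0 < u n" "u n * real n \<in> \<int>" using u elim by auto
    have un1: "u n < 1" using elim(1) u0 by linarith
    obtain k where k: "real k = u n * real n" "0 < k"
      using set_size_from_density[OF un n0] .
    have "real k < real n" using k(1) un1 n0 by simp
    hence kn: "k < n" by simp
    have uk: "real k / real n = u n" using k(1) n0 by simp
    show ?case
    proof (rule prob_min_vertex_expansion_ge[OF _ elim(2,3) k kn])
      show "1 \<le> d" using d by simp
      show "real (card (poorly_expanding n d k (l * real k)))
          \<le> real (matching_number (d * n)) * exp (- \<delta> * real n + 2 + 2 * ln (real (d * n) + 1))"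
        by (rule card_poorly_expanding_le[OF k(2) kn elim(3) xz(1-3)])
          (use neg un(1) un1 elim(1) in \<open>simp add: uk\<close>)
    qed
  qed
  have "(?q \<longlongrightarrow> 0) (admissible_orders d)"
    by (rule filterlim_compose[OF failure_probability_tendsto_0 filterlim_admissible_orders])
      (use xz d in auto)
  from tendsto_diff[OF tendsto_const[of 1] this]
  have "((\<lambda>n. 1 - ?q n) \<longlongrightarrow> 1) (admissible_orders d)" by simp
  from tendsto_sandwich[OF lower _ this tendsto_const]
  have "(?p \<longlongrightarrow> 1) (admissible_orders d)" by simp
  thus ?thesis unfolding aas_regular_def .
qed

text \<open>The supremum of an unbounded set of reals carries no information, so the bound is needed to compare the
expansion number with its members. A boundary never has more than \<open>n\<close> vertices.\<close>

lemma aas_expansion_bounded: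
  assumes d: "d \<ge> 1" and u0: "0 < u0"
    and u: "\<forall>n. even (d * n) \<longrightarrow> 0 < u n \<and> u n \<le> 1 \<and> u n * real n \<in> \<int>"
    and lim: "(u \<longlongrightarrow> u0) (admissible_orders d)"
    and aas: "aas_regular d (\<lambda>n E. min_vertex_expansion (u n) n E \<ge> l)"
  shows "l \<le> 2 / u0"
proof -
  let ?p = "\<lambda>n. measure_pmf.prob (random_regular_graph n d) {E. l \<le> min_vertex_expansion (u n) n E}"
  have "eventually (\<lambda>n. 0 < ?p n) (admissible_orders d)"
    using order_tendstoD(1)[OF aas[unfolded aas_regular_def], of 0] by simp
  moreover have "eventually (\<lambda>n. u0 / 2 < u n) (admissible_orders d)"
    using order_tendstoD(1)[OF lim, of "u0 / 2"] u0 by simp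
  moreover have "eventually (\<lambda>n. n > 32 * d) (admissible_orders d)"
    unfolding eventually_admissible_orders
    using eventually_gt_at_top[of "32 * d"] by eventually_elim simp
  moreover have "eventually (\<lambda>n. even (d * n)) (admissible_orders d)"
    unfolding eventually_admissible_orders by simp
  ultimately have "eventually (\<lambda>n. l \<le> 2 / u0) (admissible_orders d)"
  proof eventually_elim
    case (elim n)
    have n0: "0 < n" using elim by simp
    have un: "0 < u n" "u n * real n \<in> \<int>" "u n \<le> 1" using u elim by auto
    obtain k where k: "real k = u n * real n" "0 < k"
      using set_size_from_density[OF un(1,2) n0] .
    have "real k \<le> real n" using k(1) un(3) n0 by (simp add: mult_left_le_one_le)
    hence kn: "k \<le> n" by simp
    have "regular_graphs n d \<noteq> {}" using regular_graphs_nonempty[OF d elim(3,4)] .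
    hence "?p n = real (card (regular_graphs n d \<inter> {E. l \<le> min_vertex_expansion (u n) n E})) / real (card (regular_graphs n d))"
      unfolding random_regular_graph_def by (rule measure_pmf_of_set[OF _ finite_regular_graphs])
    hence "regular_graphs n d \<inter> {E. l \<le> min_vertex_expansion (u n) n E} \<noteq> {}"
      using elim(1) by force
    then obtain E where E: "E \<in> regular_graphs n d" "l \<le> min_vertex_expansion (u n) n E" by auto
    have "vertex_boundary E {..<k} \<subseteq> {..<n}"
      using E(1) by (auto simp: vertex_boundary_def regular_graphs_def)
    hence "real (card (vertex_boundary E {..<k})) \<le> real n"
      using card_mono[of "{..<n}"] by fastforce
    moreover have "l * real k \<le> real (card (vertex_boundary E {..<k}))"
      using E(2) kn unfolding min_vertex_expansion_ge_iff[OF k(1) kn k(2)] by auto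
    ultimately have "l * u n * real n \<le> 1 * real n" unfolding k(1) by (simp add: mult.assoc)
    hence "l * u n \<le> 1" using n0 by (simp only: mult_le_cancel_right_pos of_nat_0_less_iff)
    hence "l \<le> 1 / u n" using un by (simp add: field_simps)
    also have "\<dots> \<le> 1 / (u0 / 2)" using elim(2) u0 un by (intro divide_left_mono) auto
    finally show ?case by simp
  qed
  thus ?thesis using admissible_orders_neq_bot[of d] by (simp add: eventually_const)
qed

theorem corollary9:
  fixes d :: nat and u0 :: real and u :: "nat \<Rightarrow> real"
  assumes "d \<ge> 3"
    and "0 < u0" and "u0 \<le> 1/2"
    and "\<And>n. even (d * n) \<Longrightarrow> 0 < u n \<and> u n \<le> 1 \<and> u n * real n \<in> \<int>"
    and "(u \<longlongrightarrow> u0) (admissible_orders d)"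
  shows "vertex_expansion_number u d \<ge> A_exp d u0"
proof (rule dense_le)
  have u: "\<forall>n. even (d * n) \<longrightarrow> 0 < u n \<and> u n \<le> 1 \<and> u n * real n \<in> \<int>"
    using assms(4) by blast
  let ?L = "{l. aas_regular d (\<lambda>n E. min_vertex_expansion (u n) n E \<ge> l)}"
  fix l assume "l < A_exp d u0"
  hence "l \<in> ?L" using aas_expansion_below_A[OF assms(1-3) u assms(5)] by simp
  moreover have "bdd_above ?L"
  proof (rule bdd_aboveI)
    fix l assume "l \<in> ?L"
    thus "l \<le> 2 / u0" using aas_expansion_bounded[OF _ assms(2) u assms(5)] assms(1) by simp
  qed
  ultimately show "l \<le> vertex_expansion_number u d"
    unfolding vertex_expansion_number_def by (rule cSup_upper)
qed

end
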